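(* Let $M=M(b;(a_1,b_1),\dots,(a_k,b_k))$ be a negative definite Seifert manifold with $b_1(M)=0$, presented by its star-shaped plumbing tree with one node of degree $k$ and $k$ legs, and let $|H|=|H_1(M;\mathbb{Z})|$. Let $A=\prod_{i=1}^k a_i$, $\overline{a_i}=A/a_i$, and $$f_0(t,z)=\frac{\prod_{i=1}^k\left(z^{\overline{a_i}}t^{-1}-z^{-\overline{a_i}}t\right)}{\left(z^{A}t^{-1}-z^{-A}t\right)^{k-2}}.$$ Then $$\widehat{\widehat{Z}}_0(M)(t^2,q^{|H|})=q^{\Delta}\,\mathcal{L}_A\big(\mathrm{s.e.}(f_0(t,z))\big),$$ where $\Delta\in\mathbb{Q}$ is the number, determined by the plumbing, given in the context.
   Context: **Plumbing.** A plumbing tree $\Gamma$ is a finite tree with $s$ ordered vertices $v_i$ carrying integer weights $m_i$; $m=(m_i)\in\mathbb{Z}^s$ is the weight vector, $\delta\in\mathbb{Z}^s$ is the vector of vertex degrees, and $u=(1,\dots,1)$. The plumbing matrix, also denoted $M$, has $M_{ii}=m_i$, $M_{ij}=1$ if $v_i,v_j$ are joined by an edge, and $0$ otherwise. $M(\Gamma)$ is the 3-manifold obtained by Dehn surgery on the associated framed link of unknots clasped according to the edges. The manifold is negative definite if the matrix $M$ is; then $|H_1(M;\mathbb{Z})|=|\det M|$. Vertices of degree $1$ are leaves, of degree $2$ joints, of degree $\ge 3$ nodes. **Seifert manifolds.** For coprime pairs $(a_i,b_i)$, $a_i>0$, $k\ge 3$, the plumbing tree of $M(b;(a_1,b_1),\dots,(a_k,b_k))$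 has one node of weight $-b$ and degree $k$, to which $k$ linear legs are attached. Going outwards from the node, the $i$-th leg has weights $-c^i_1,\dots,-c^i_{\ell_i}$, where $\frac{a_i}{b_i}=c^i_1-\cfrac{1}{c^i_2-\cfrac{1}{\ddots-\cfrac{1}{c^i_{\ell_i}}}}$. Vertices are indexed $0,1,\dots,s-1$ so that $0$ is the node, $1,\dots,k$ are the leaves (leaf $i$ at the end of leg $i$), and the remaining vertices are joints. **Symmetric expansion.** If a function $f$ has Laurent expansions $\sum_k a_kz^k$ centered at $z=0$ and $\sum_k b_kz^{-k}$ centered at $z=\infty$, then $\mathrm{s.e.}(f)=\frac12\sum_k a_kz^k+\frac12\sum_k b_kz^{-k}$ as a formal (bilateral) series. For $f_0(t,z)$ these are the expansions in the regions $|z^At^{-1}|<1$ and $|z^At^{-1}|>1$, with coefficients Laurent polynomials in $t$. **The invariant.** For $d\in\mathbb{N}$, $n\in\mathbb{Z}$, let $\widehat W_d(n)$ be the coefficient of $z^{-n}$ in $\mathrm{s.e.}((z-z^{-1})^{2-d})$. Spin$^c$ structures are identified with classes $[k]\in(m+2\mathbb{Z}^s)/2M\mathbb{Z}^s$. Write $\langle x,y\rangle=x^tMy$ and let $\cdot$ be the Euclidean inner product. For $x\in\mathbb{Z}^s$ put $\chi_k(x)=-\frac{k\cdot x+\langle x,x\rangle}{2}$, $\Theta_k=\frac{k\cdot u-\langle u,u\rangle}{2}$, and $$\varepsilon_k(x)=-\frac{(k-Mu)^tM^{-1}(k-Mu)+3s+\sum_i m_i}{4}+2\chi_k(x)+\langle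 x,u\rangle.$$ Then $$\widehat{\widehat Z}_{[k]}(M)(t,q)=\sum_{x\in\mathbb{Z}^s}\Big(\prod_{i}\widehat W_{\delta_i}\big((2Mx+k-Mu)_i\big)\Big)q^{\varepsilon_k(x)}t^{\Theta_k+\langle x,u\rangle},$$ which depends only on $[k]$, and $\widehat{\widehat Z}_0(M)(t,q)=\sum_{[k]}\widehat{\widehat Z}_{[k]}(M)(t,q)$, the sum over all spin$^c$ structures. **Laplace transform.** $\mathcal{L}_A$ is the linear map on formal series sending $z^nt^r\mapsto q^{n^2/(4A)}t^r$. **Prefactor.** With $M'=(-1)^s\,\mathrm{adj}(M)$ (adjugate matrix), $$\Delta=-\frac{|H|\,(3s+\mathrm{Tr}\,M)}{4}-\frac14\sum_{i=1}^k\left(M'_{ii}+\frac{A}{a_i^2}\right).$$ *)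

theory Defs
  imports
    "HOL-Computational_Algebra.Formal_Laurent_Series"
    "Jordan_Normal_Form.Gauss_Jordan_Elimination"
    "Jordan_Normal_Form.DL_Rank"
begin

section \<open>Plumbing trees\<close>

text \<open>The vertices are \<open>0, \<dots>, nverts - 1\<close>.\<close>

record plumbing =
  nverts :: nat
  adj :: "nat \<Rightarrow> nat \<Rightarrow> bool"
  wt :: "nat \<Rightarrow> int"

definition is_cycle :: "plumbing \<Rightarrow> nat list \<Rightarrow> bool" where
  "is_cycle \<Gamma> p \<longleftrightarrow> 3 \<le> length p \<and> distinct p \<and> successively (adj \<Gamma>) p \<and> adj \<Gamma> (last p) (hd p)"

definition plumbing_tree :: "plumbing \<Rightarrow> bool" where
  "plumbing_tree \<Gamma> \<longleftrightarrow>
     0 < nverts \<Gamma> \<and>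
     (\<forall>i j. adj \<Gamma> i j \<longrightarrow> i < nverts \<Gamma> \<and> j < nverts \<Gamma> \<and> i \<noteq> j \<and> adj \<Gamma> j i) \<and>
     (\<forall>i < nverts \<Gamma>. \<forall>j < nverts \<Gamma>. (adj \<Gamma>)\<^sup>*\<^sup>* i j) \<and>
     (\<nexists>p. is_cycle \<Gamma> p)"

definition deg :: "plumbing \<Rightarrow> nat \<Rightarrow> nat" where
  "deg \<Gamma> i = card {j. j < nverts \<Gamma> \<and> adj \<Gamma> i j}"

definition plumbing_matrix :: "plumbing \<Rightarrow> int mat" where
  "plumbing_matrix \<Gamma> = mat (nverts \<Gamma>) (nverts \<Gamma>)
     (\<lambda>(i, j). if i = j then wt \<Gamma> i else if adj \<Gamma> i j then 1 else 0)"

definition negative_definite :: "real mat \<Rightarrow> bool" where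
  "negative_definite A \<longleftrightarrow>
     (\<forall>x \<in> carrier_vec (dim_row A). x \<noteq> 0\<^sub>v (dim_row A) \<longrightarrow> x \<bullet> (A *\<^sub>v x) < 0)"

text \<open>
  The 3-manifold is not constructed; it enters only through its plumbing. The plumbing matrix
  presents its first homology group. So the first Betti number is the corank, and, when the
  matrix is nondegenerate, the order of \<open>H\<^sub>1\<close> is the absolute value of the determinant.
\<close>

definition betti1 :: "plumbing \<Rightarrow> nat" where
  "betti1 \<Gamma> = nverts \<Gamma> - vec_space.rank (nverts \<Gamma>) (map_mat rat_of_int (plumbing_matrix \<Gamma>))"

definition homology_order :: "plumbing \<Rightarrow> int" where
  "homology_order \<Gamma> = \<bar>det (plumbing_matrix \<Gamma>)\<bar>"


section \<open>Seifert manifolds\<close>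

fun neg_cont_frac :: "rat list \<Rightarrow> rat" where
  "neg_cont_frac [] = 0"
| "neg_cont_frac [c] = c"
| "neg_cont_frac (c # c' # cs) = c - 1 / neg_cont_frac (c' # cs)"

text \<open>
  \<open>seifert_plumbing \<Gamma> b k a \<beta>\<close>: \<open>\<Gamma>\<close> is a plumbing tree of
  \<open>M(b; (a 1, \<beta> 1), \<dots>, (a k, \<beta> k))\<close>. The list \<open>legs i\<close> contains the vertices of the
  \<open>i\<close>-th leg from the node outwards, so it ends in the leaf \<open>i\<close>. The vertices greater than
  \<open>k\<close> are the joints, in any order. When the plumbing matrix is negative definite, no
  denominator in the continued fractions vanishes, and \<open>\<beta> i > 0\<close>.
\<close>

definition seifert_plumbing ::
    "plumbing \<Rightarrow> int \<Rightarrow> nat \<Rightarrow> (nat \<Rightarrow> int) \<Rightarrow> (nat \<Rightarrow> int) \<Rightarrow> bool" where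
  "seifert_plumbing \<Gamma> b k a \<beta> \<longleftrightarrow>
     plumbing_tree \<Gamma> \<and> 3 \<le> k \<and>
     (\<forall>i \<in> {1..k}. 0 < a i \<and> coprime (a i) (\<beta> i)) \<and>
     wt \<Gamma> 0 = - b \<and>
     (\<exists>legs :: nat \<Rightarrow> nat list.
        (\<forall>i \<in> {1..k}. legs i \<noteq> [] \<and> last (legs i) = i \<and>
           of_int (a i) / of_int (\<beta> i) =
             neg_cont_frac (map (\<lambda>v. rat_of_int (- wt \<Gamma> v)) (legs i))) \<and>
        distinct (concat (map legs [1..<Suc k])) \<and>
        set (concat (map legs [1..<Suc k])) = {1..<nverts \<Gamma>} \<and>
        (\<forall>u v. adj \<Gamma> u v \<longleftrightarrow>
           (\<exists>i \<in> {1..k}. \<exists>j < length (legs i).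
              {u, v} = {(0 # legs i) ! j, (0 # legs i) ! Suc j})))"


section \<open>Symmetric expansion\<close>

text \<open>
  A rational function of \<open>z\<close> is given by an expression \<open>f\<close> in field operations that is
  evaluated in the field of formal Laurent series. At the generator \<open>X\<close> this gives the
  expansion of \<open>f\<close> at \<open>z = 0\<close>. At \<open>1 / X\<close> it gives the expansion at \<open>z = \<infinity>\<close>, where \<open>X\<close>
  stands for \<open>1 / z\<close>. The result is the coefficient of \<open>z\<^sup>n\<close>.
\<close>

definition sym_exp :: "('a::field fls \<Rightarrow> 'a fls) \<Rightarrow> int \<Rightarrow> 'a" where
  "sym_exp f n = (fls_nth (f fls_X) n + fls_nth (f (inverse fls_X)) (- n)) / 2"

definition W_hat :: "nat \<Rightarrow> int \<Rightarrow> rat" where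
  "W_hat d n = sym_exp (\<lambda>z. (z - inverse z) powi (2 - int d)) (- n)"

definition A_prod :: "nat \<Rightarrow> (nat \<Rightarrow> int) \<Rightarrow> int" where
  "A_prod k a = (\<Prod>i = 1..k. a i)"

definition a_bar :: "nat \<Rightarrow> (nat \<Rightarrow> int) \<Rightarrow> nat \<Rightarrow> int" where
  "a_bar k a i = A_prod k a div a i"

definition f0 :: "nat \<Rightarrow> (nat \<Rightarrow> int) \<Rightarrow> 'a::field \<Rightarrow> 'a \<Rightarrow> 'a" where
  "f0 k a t z =
     (\<Prod>i = 1..k. z powi a_bar k a i * inverse t - z powi (- a_bar k a i) * t) /
     (z powi A_prod k a * inverse t - z powi (- A_prod k a) * t) ^ (k - 2)"

text \<open>
  Formal series in \<open>z, t\<close> and in \<open>q, t\<close> are given by their coefficients: \<open>F n r\<close> is the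
  coefficient of \<open>z\<^sup>n t\<^sup>r\<close>, and \<open>G e r\<close> is the coefficient of \<open>q\<^sup>e t\<^sup>r\<close>.
\<close>

type_synonym zt_series = "int \<Rightarrow> int \<Rightarrow> rat"
type_synonym qt_series = "rat \<Rightarrow> rat \<Rightarrow> rat"

text \<open>
  The rational functions of \<open>t\<close> are embedded in \<open>rat fls\<close>. The expansions of \<open>f0\<close> have
  Laurent polynomials in \<open>t\<close> as coefficients, so no choice of expansion in \<open>t\<close> is involved.
\<close>

definition sym_exp_f0 :: "nat \<Rightarrow> (nat \<Rightarrow> int) \<Rightarrow> zt_series" where
  "sym_exp_f0 k a n r = fls_nth (sym_exp (f0 k a (fls_const (fls_X :: rat fls))) n) r"


section \<open>Operations on formal series\<close>

text \<open>For \<open>A \<noteq> 0\<close> at most two monomials \<open>z\<^sup>n t\<^sup>m\<close> are sent to a given \<open>q\<^sup>e t\<^sup>r\<close>.\<close>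

definition laplace :: "int \<Rightarrow> zt_series \<Rightarrow> qt_series" where
  "laplace A F e r =
     (\<Sum>(n, m) | (of_int n)\<^sup>2 / (4 * of_int A) = e \<and> of_int m = r. F n m)"

text \<open>\<open>subst_powers c h F\<close> is \<open>F(t\<^sup>c, q\<^sup>h)\<close>, for nonzero \<open>c\<close> and \<open>h\<close>.\<close>

definition subst_powers :: "rat \<Rightarrow> rat \<Rightarrow> qt_series \<Rightarrow> qt_series" where
  "subst_powers c h F e r = F (e / h) (r / c)"

definition q_power_times :: "rat \<Rightarrow> qt_series \<Rightarrow> qt_series" where
  "q_power_times d F e r = F (e - d) r"


section \<open>The invariant\<close>

definition uvec :: "plumbing \<Rightarrow> int vec" where
  "uvec \<Gamma> = vec (nverts \<Gamma>) (\<lambda>_. 1)"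

definition mform :: "plumbing \<Rightarrow> int vec \<Rightarrow> int vec \<Rightarrow> int" where
  "mform \<Gamma> x y = x \<bullet> (plumbing_matrix \<Gamma> *\<^sub>v y)"

definition trace_wt :: "plumbing \<Rightarrow> int" where
  "trace_wt \<Gamma> = (\<Sum>i < nverts \<Gamma>. wt \<Gamma> i)"

definition chi :: "plumbing \<Rightarrow> int vec \<Rightarrow> int vec \<Rightarrow> rat" where
  "chi \<Gamma> k x = - of_int (k \<bullet> x + mform \<Gamma> x x) / 2"

definition Theta :: "plumbing \<Rightarrow> int vec \<Rightarrow> rat" where
  "Theta \<Gamma> k = of_int (k \<bullet> uvec \<Gamma> - mform \<Gamma> (uvec \<Gamma>) (uvec \<Gamma>)) / 2"

definition M_inv :: "plumbing \<Rightarrow> rat mat" where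
  "M_inv \<Gamma> = the (mat_inverse (map_mat rat_of_int (plumbing_matrix \<Gamma>)))"

definition eps :: "plumbing \<Rightarrow> int vec \<Rightarrow> int vec \<Rightarrow> rat" where
  "eps \<Gamma> k x =
     (let w = map_vec rat_of_int (k - plumbing_matrix \<Gamma> *\<^sub>v uvec \<Gamma>) in
      - (w \<bullet> (M_inv \<Gamma> *\<^sub>v w) + of_int (3 * int (nverts \<Gamma>) + trace_wt \<Gamma>)) / 4
      + 2 * chi \<Gamma> k x + of_int (mform \<Gamma> x (uvec \<Gamma>)))"

text \<open>
  The set of \<open>x\<close> contributing to a given monomial is finite when the plumbing matrix is
  negative definite, because \<open>eps \<Gamma> k\<close> is then a positive definite quadratic polynomial.
\<close>

definition Z_hat_hat :: "plumbing \<Rightarrow> int vec \<Rightarrow> qt_series" where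
  "Z_hat_hat \<Gamma> k e r =
     (\<Sum>x | x \<in> carrier_vec (nverts \<Gamma>) \<and> eps \<Gamma> k x = e \<and>
            Theta \<Gamma> k + of_int (mform \<Gamma> x (uvec \<Gamma>)) = r.
        \<Prod>i < nverts \<Gamma>. W_hat (deg \<Gamma> i)
          (vec_index (2 \<cdot>\<^sub>v (plumbing_matrix \<Gamma> *\<^sub>v x) + k - plumbing_matrix \<Gamma> *\<^sub>v uvec \<Gamma>) i))"

definition characteristic_vectors :: "plumbing \<Rightarrow> int vec set" where
  "characteristic_vectors \<Gamma> =
     {k \<in> carrier_vec (nverts \<Gamma>). \<forall>i < nverts \<Gamma>. even (vec_index k i - wt \<Gamma> i)}"

definition spinc :: "plumbing \<Rightarrow> int vec set set" where
  "spinc \<Gamma> = characteristic_vectors \<Gamma> //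
     {(k, k'). k \<in> characteristic_vectors \<Gamma> \<and> k' \<in> characteristic_vectors \<Gamma> \<and>
        (\<exists>x \<in> carrier_vec (nverts \<Gamma>). k' = k + 2 \<cdot>\<^sub>v (plumbing_matrix \<Gamma> *\<^sub>v x))}"

text \<open>\<open>Z_hat_hat \<Gamma> k\<close> depends only on the class of \<open>k\<close>, so the choice of \<open>k\<close> is immaterial.\<close>

definition Z_hat_hat_0 :: "plumbing \<Rightarrow> qt_series" where
  "Z_hat_hat_0 \<Gamma> e r = (\<Sum>K \<in> spinc \<Gamma>. Z_hat_hat \<Gamma> (SOME k. k \<in> K) e r)"


section \<open>The prefactor\<close>

definition M_prime :: "plumbing \<Rightarrow> int mat" where
  "M_prime \<Gamma> = (- 1) ^ nverts \<Gamma> \<cdot>\<^sub>m adj_mat (plumbing_matrix \<Gamma>)"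

definition Delta :: "plumbing \<Rightarrow> nat \<Rightarrow> (nat \<Rightarrow> int) \<Rightarrow> rat" where
  "Delta \<Gamma> k a =
     - of_int (homology_order \<Gamma> * (3 * int (nverts \<Gamma>) + trace_wt \<Gamma>)) / 4
     - (\<Sum>i = 1..k. of_int (index_mat (M_prime \<Gamma>) (i, i)) +
                    of_int (A_prod k a) / (of_int (a i))\<^sup>2) / 4"

end

theory Submission
  imports Defs
begin

text \<open>
  Both sides are sums over the same finite data, an integer \<open>m\<close> at the node and a sign at each
  leaf, and the theorem is a comparison of the two monomials attached to such data.

  For the left-hand side, substitute \<open>l = 2Mx + \<kappa> - Mu\<close>. When \<open>\<kappa>\<close> runs through representatives
  of the spin\<open>\<^sup>c\<close> structures and \<open>x\<close> through all integer vectors, \<open>l\<close> runs once through all vectors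
  congruent to the degree vector modulo 2, because \<open>M\<close> is injective and \<open>(Mu)\<^sub>i\<close> is the weight plus
  the degree of \<open>i\<close> (\<open>bij_translate\<close>). Completing the square turns the exponents into
  \<open>- (l\<^sup>T M\<^sup>-\<^sup>1 l + 3s + Tr M) / 4\<close> for \<open>q\<close> and \<open>l \<bullet> u / 2\<close> for \<open>t\<close> (\<open>eps_translate\<close>,
  \<open>Theta_translate\<close>). The factor of \<open>l\<close> at a joint forces \<open>l\<^sub>i = 0\<close>, and the one at a leaf forces
  \<open>l\<^sub>i = \<plusminus>1\<close>; only \<open>l\<^sub>0 = m\<close> at the node stays free. So the invariant is a sum over \<open>m\<close> and the set
  \<open>X\<close> of leaves with sign \<open>+1\<close> (\<open>Z_hat_hat_0_leaf_sum\<close>).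

  On such vectors the quadratic form is explicit. Gauss elimination along the legs, from the
  leaves towards the node, has quotients of consecutive tail continuants of the legs as its pivots,
  up to sign. The tail continuants are positive because \<open>M\<close> is negative definite, so the
  continuant of leg \<open>i\<close> is the reduced numerator \<open>a\<^sub>i\<close> of its continued fraction. The elimination yields \<open>det M\<close> (\<open>det_plumbing_matrix\<close>) and those
  entries of \<open>M' = |H| M\<^sup>-\<^sup>1\<close> that matter: \<open>M'\<^sub>0\<^sub>0 = -A\<close>, \<open>M'\<^sub>0\<^sub>i = -A/a\<^sub>i\<close> and
  \<open>M'\<^sub>i\<^sub>j = -A/(a\<^sub>i a\<^sub>j)\<close> for different leaves \<open>i\<close> and \<open>j\<close>. Only the diagonal entries at
  the leaves fail to be of rank one, and as \<open>l\<^sub>i\<^sup>2 = 1\<close> there, they contribute a constant: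
  \<open>- l\<^sup>T M' l = N\<^sup>2 / A - \<Sum>\<^sub>i (M'\<^sub>i\<^sub>i + A / a\<^sub>i\<^sup>2)\<close> with \<open>N = A m + \<Sum>\<^sub>i \<plusminus> A/a\<^sub>i\<close>
  (\<open>dual_form_charge\<close>). The constant goes into the prefactor, and \<open>N\<^sup>2 / (4A)\<close> is a Laplace exponent.

  For the right-hand side, expand the product in the numerator of \<open>f\<^sub>0\<close>. The denominator is a
  power of \<open>y - y\<^sup>-\<^sup>1\<close> with \<open>y = z\<^sup>A t\<^sup>-\<^sup>1\<close>, and its symmetric expansion has the coefficients
  \<open>W_hat k\<close> of the node in the powers of \<open>y\<close> (\<open>sym_exp_pole\<close>). Hence \<open>f\<^sub>0\<close> is the sum over \<open>m\<close> and
  \<open>X\<close> of the monomials \<open>z\<^sup>-\<^sup>N t\<^sup>r\<close> with \<open>r = l \<bullet> u\<close> and with the same coefficients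
  (\<open>sym_exp_f0_eq\<close>). The Laplace transform does not see the sign of the exponent of \<open>z\<close>.

  Formal series are coefficient functions and infinite sums are zero by convention, so finiteness
  of the sets of spin\<open>\<^sup>c\<close> structures and of contributing vectors is part of the argument
  (\<open>finite_spinc\<close>, \<open>finite_q_exponent_level\<close>).
\<close>

section \<open>Expansions of the negative powers of \<open>z - z\<^sup>-\<^sup>1\<close>\<close>

definition pole_coeff :: "nat \<Rightarrow> int \<Rightarrow> 'a::field" where
  "pole_coeff m n = fls_nth (inverse ((fls_X - inverse fls_X) ^ m)) n"

lemma fls_nth_monom_times:
  "fls_nth (fls_const (c::'a::field) * fls_X_intpow e * f) n = c * fls_nth f (n - e)"
  unfolding mult.assoc unfolding fls_X_intpow_times_conv_shift(1) by simp

lemma monom_minus_inverse_neq_0: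
  fixes c :: "'a::field"
  assumes "c \<noteq> 0" "e > 0"
  shows "fls_const c * fls_X_intpow e - fls_const (inverse c) * fls_X_intpow (- e) \<noteq> 0"
proof
  assume "fls_const c * fls_X_intpow e - fls_const (inverse c) * fls_X_intpow (- e) = 0"
  then have "fls_nth (fls_const c * fls_X_intpow e - fls_const (inverse c) * fls_X_intpow (- e)) e = 0"
    by simp
  then show False using assms by simp
qed

lemma inverse_power_minus:
  "inverse ((- w) ^ m) = fls_const ((- 1) ^ m) * inverse (w ^ m)" for w :: "'a::field fls"
  by (cases "even m") auto

lemma pole_coeff_0: "pole_coeff 0 n = (if n = 0 then 1 else 0)"
  by (simp add: pole_coeff_def)

lemma inverse_power_Suc_mult:
  fixes w :: "'a::field"
  assumes "w \<noteq> 0"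
  shows "w * inverse (w ^ Suc m) = inverse (w ^ m)"
  using assms by (simp add: field_simps)

text \<open>
  Multiplication by \<open>X - X\<^sup>-\<^sup>1\<close> lowers \<open>m\<close> by one. In this form the expansion can be
  carried over to other base fields and to other bases than \<open>X\<close>.
\<close>
lemma pole_coeff_rec:
  "pole_coeff (Suc m) (n - 1) - pole_coeff (Suc m) (n + 1) = (pole_coeff m n :: 'a::field)"
proof -
  let ?w = "fls_X - inverse fls_X :: 'a fls"
  have w: "?w = fls_const 1 * fls_X_intpow 1 - fls_const (inverse 1) * fls_X_intpow (-1)"
    by (simp add: fls_X_conv_shift_1 fls_inverse_X_intpow)
  have "?w \<noteq> 0" unfolding w by (rule monom_minus_inverse_neq_0) auto
  then have "?w * inverse (?w ^ Suc m) = inverse (?w ^ m)"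
    by (rule inverse_power_Suc_mult)
  then have "fls_nth (?w * inverse (?w ^ Suc m)) n = pole_coeff m n"
    by (simp only: pole_coeff_def)
  moreover have "fls_nth (?w * inverse (?w ^ Suc m)) n
      = fls_nth (fls_const 1 * fls_X_intpow 1 * inverse (?w ^ Suc m)) n
        - fls_nth (fls_const (inverse 1) * fls_X_intpow (-1) * inverse (?w ^ Suc m)) n"
    by (subst w) (simp only: left_diff_distrib fls_minus_nth)
  ultimately show ?thesis
    by (simp only: fls_nth_monom_times) (simp add: pole_coeff_def)
qed

text \<open>
  The expansion is compatible with the substitution of \<open>c X\<^sup>e\<close> for \<open>X\<close> and with a change of the
  base field along \<open>h\<close>: the substituted series satisfies the recursion \<open>pole_coeff_rec\<close> as well.
  Take \<open>c = t\<^sup>\<plusminus>\<^sup>1\<close> and \<open>e = A\<close> for the denominator of \<open>f\<^sub>0\<close>, and \<open>c = -1\<close> for parity.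
\<close>
lemma pole_expansion:
  fixes c :: "'a::field" and h :: "'b::field \<Rightarrow> 'a"
  assumes hom: "\<And>x y. h (x - y) = h x - h y" "h 1 = 1"
    and c: "c \<noteq> 0" and e: "e > 0"
  shows "fls_nth (inverse ((fls_const c * fls_X_intpow e
             - fls_const (inverse c) * fls_X_intpow (- e)) ^ m)) N =
         (if e dvd N then h (pole_coeff m (N div e)) * c powi (N div e) else 0)"
proof (induction m arbitrary: N)
  case 0
  have "h 0 = 0" using hom(1)[of 0 0] by simp
  then show ?case using hom(2) e by (auto simp: pole_coeff_0)
next
  case (Suc m)
  let ?w = "fls_const c * fls_X_intpow e - fls_const (inverse c) * fls_X_intpow (- e)"
  define G where "G = Abs_fls (\<lambda>N. if e dvd N then h (pole_coeff (Suc m) (N div e)) * c powi (N div e) else 0)"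
  have h0: "h 0 = 0" using hom(1)[of 0 0] by simp
  have G: "fls_nth G N = (if e dvd N then h (pole_coeff (Suc m) (N div e)) * c powi (N div e) else 0)" for N
  proof -
    (* Abs_fls needs a bound below which the coefficients vanish. *)
    obtain n0 where n0: "\<And>n. n < n0 \<Longrightarrow> (pole_coeff (Suc m) n :: 'b) = 0"
      unfolding pole_coeff_def by (meson fls_eq0_below_subdegree)
    have "\<forall>N < min 0 (e * n0). (if e dvd N then h (pole_coeff (Suc m) (N div e)) * c powi (N div e) else 0) = 0"
    proof (intro allI impI)
      fix N assume N: "N < min 0 (e * n0)"
      have "(pole_coeff (Suc m) (N div e) :: 'b) = 0" if "e dvd N"
        using that e N by (intro n0) (auto simp: dvd_def)
      then show "(if e dvd N then h (pole_coeff (Suc m) (N div e)) * c powi (N div e) else 0) = 0"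
        using h0 by simp
    qed
    then show ?thesis unfolding G_def by (subst nth_Abs_fls_lower_bound[of "min 0 (e * n0)"]) blast+
  qed
  have w0: "?w \<noteq> 0" by (rule monom_minus_inverse_neq_0[OF c e])
  \<comment> \<open>\<open>G\<close> is the claimed expansion of order \<open>Suc m\<close>; a nonzero multiple identifies it.\<close>
  have "fls_nth (?w * G) N = fls_nth (inverse (?w ^ m)) N" for N
  proof -
    have "fls_nth (?w * G) N = c * fls_nth G (N - e) - inverse c * fls_nth G (N + e)"
      by (simp only: left_diff_distrib fls_minus_nth fls_nth_monom_times) simp
    also have "\<dots> = (if e dvd N then h (pole_coeff m (N div e)) * c powi (N div e) else 0)"
    proof (cases "e dvd N")
      case True
      then obtain n where n: "N = e * n" by (auto simp: dvd_def)
      have d: "(N - e) div e = n - 1" "(N + e) div e = n + 1" "e dvd N - e" "e dvd N + e"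
        using e by (auto simp: n div_diff)
      have "c * fls_nth G (N - e) - inverse c * fls_nth G (N + e)
          = h (pole_coeff (Suc m) (n - 1)) * (c * c powi (n - 1))
            - h (pole_coeff (Suc m) (n + 1)) * (inverse c * c powi (n + 1))"
        using d by (simp add: G)
      also have "c * c powi (n - 1) = c powi n"
        using c by (simp add: power_int_diff)
      also have "inverse c * c powi (n + 1) = c powi n"
        using c by (simp add: power_int_add)
      also have "h (pole_coeff (Suc m) (n - 1)) * c powi n - h (pole_coeff (Suc m) (n + 1)) * c powi n
          = h (pole_coeff m n) * c powi n"
        by (simp only: left_diff_distrib[symmetric] hom(1)[symmetric] pole_coeff_rec)
      finally show ?thesis using n e by simp
    next
      case False
      then have "\<not> e dvd N - e" "\<not> e dvd N + e" using dvd_add_triv_right_iff[of e "N - e"] by auto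
      then show ?thesis using False by (simp add: G)
    qed
    finally show ?thesis using Suc.IH by simp
  qed
  then have "?w * G = ?w * inverse (?w ^ Suc m)"
    unfolding inverse_power_Suc_mult[OF w0] by (intro fls_eqI) auto
  then have "G = inverse (?w ^ Suc m)" using w0 by simp
  then show ?case using G by simp
qed

lemma pole_coeff_parity:
  "pole_coeff m n * (- 1) powi n = (- 1) ^ m * (pole_coeff m n :: 'a::field)"
proof -
  let ?w = "fls_X - inverse fls_X :: 'a fls"
  have w: "fls_const (-1) * fls_X_intpow 1 - fls_const (inverse (-1)) * fls_X_intpow (-1) = - ?w"
    by (simp add: fls_X_conv_shift_1 fls_inverse_X_intpow)
  show ?thesis
    using pole_expansion[of "\<lambda>x. x" "-1 :: 'a" 1 m n] unfolding w inverse_power_minus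
    by (auto simp: pole_coeff_def)
qed

lemma W_hat_pole:
  "W_hat (m + 2) n = (pole_coeff m (- n) + (- 1) ^ m * pole_coeff m n) / 2"
proof -
  let ?w = "fls_X - inverse fls_X :: rat fls"
  have p: "2 - int (m + 2) = - int m" by simp
  have "inverse ((inverse fls_X - inverse (inverse fls_X :: rat fls)) ^ m)
      = fls_const ((- 1) ^ m) * inverse (?w ^ m)"
  proof -
    have "inverse fls_X - inverse (inverse fls_X :: rat fls) = - ?w" by simp
    then show ?thesis by (simp only: inverse_power_minus)
  qed
  then show ?thesis
    unfolding W_hat_def sym_exp_def p power_int_minus power_int_of_nat
    by (simp add: pole_coeff_def)
qed

text \<open>
  The function \<open>z - z\<^sup>-\<^sup>1\<close> is odd, so each of its powers has exponents of one parity only. Thus a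
  vector with nonzero weight is automatically congruent to the degree vector modulo 2 at the node.
\<close>
lemma W_hat_parity:
  assumes "W_hat (m + 2) n \<noteq> 0"
  shows "even (n - int m)"
proof (rule ccontr)
  assume "odd (n - int m)"
  then have "(-1 :: rat) powi n = - ((- 1) ^ m)" "(-1 :: rat) powi (-n) = - ((- 1) ^ m)"
    by (cases "even m"; auto simp: power_int_minus_left)+
  then have "pole_coeff m n = (0::rat)" "pole_coeff m (-n) = (0::rat)"
    using pole_coeff_parity[of m n, where 'a=rat] pole_coeff_parity[of m "-n", where 'a=rat]
    by (cases "even m"; auto)+
  then show False using assms by (simp only: W_hat_pole) simp
qed

lemma W_hat_1: "W_hat 1 n = (if n = -1 then 1 else if n = 1 then -1 else 0)"
proof -
  have "(2 - int 1) = 1" by simp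
  then have "W_hat 1 n = (fls_nth (fls_X - inverse fls_X) (- n)
      + fls_nth (inverse fls_X - fls_X) n) / 2"
    unfolding W_hat_def sym_exp_def by (simp only: power_int_1_right minus_minus inverse_inverse_eq)
  then show ?thesis
    unfolding fls_inverse_X by (cases "n = 1"; cases "n = -1"; simp)
qed

lemma W_hat_2: "W_hat 2 n = (if n = 0 then 1 else 0)"
proof -
  have "(2 - int 2) = 0" by simp
  then show ?thesis
    unfolding W_hat_def sym_exp_def by (simp only: power_int_0_right) simp
qed

lemma sym_exp_sum: "sym_exp (\<lambda>z. \<Sum>x\<in>S. F x z) n = (\<Sum>x\<in>S. sym_exp (F x) n)"
  by (simp add: sym_exp_def fls_nth_sum sum.distrib sum_divide_distrib add_divide_distrib)

lemma inverse_fls_X_powi: "inverse fls_X powi e = (fls_X_intpow (- e) :: 'a::field fls)"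
proof -
  have "inverse fls_X powi e = inverse (fls_X powi e :: 'a fls)"
    by (simp only: power_int_inverse)
  then show ?thesis by (simp add: fls_inverse_X_intpow)
qed

lemma sym_exp_monom_times:
  fixes c :: "'a::field"
  shows "sym_exp (\<lambda>z. fls_const c * z powi e * F z) n = c * sym_exp F (n - e)"
proof -
  have "sym_exp (\<lambda>z. fls_const c * z powi e * F z) n
     = (fls_nth (fls_const c * fls_X_intpow e * F fls_X) n
       + fls_nth (fls_const c * fls_X_intpow (- e) * F (inverse fls_X)) (- n)) / 2"
    by (simp only: sym_exp_def fls_X_power_int inverse_fls_X_powi)
  also have "\<dots> = c * sym_exp F (n - e)"
    unfolding fls_nth_monom_times by (simp add: sym_exp_def distrib_left)
  finally show ?thesis .
qed

text \<open>
  At \<open>z = \<infinity>\<close> the role of \<open>c = \<tau>\<^sup>-\<^sup>1\<close> is taken by \<open>c = \<tau>\<close>, and the base changes its sign. Averaging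
  the two expansions gives the coefficients of the symmetric expansion of \<open>(y - y\<^sup>-\<^sup>1)\<^sup>-\<^sup>m\<close> in
  \<open>y = z\<^sup>e \<tau>\<^sup>-\<^sup>1\<close>, and these are the values of \<open>W_hat\<close> at a node of degree \<open>m + 2\<close>.
\<close>
lemma sym_exp_pole:
  fixes \<tau> :: "'a::field" and h :: "rat \<Rightarrow> 'a"
  assumes hom: "\<And>x y. h (x - y) = h x - h y" "h 1 = 1" "\<And>x y. h (x * y) = h x * h y"
    and char: "(2::'a) \<noteq> 0"
    and t: "\<tau> \<noteq> 0" and e: "e > 0"
  shows "sym_exp (\<lambda>z. inverse ((z powi e * inverse (fls_const \<tau>) - z powi (- e) * fls_const \<tau>) ^ m)) N
       = (if e dvd N then h (W_hat (m + 2) (- (N div e))) * \<tau> powi (- (N div e)) else 0)"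
proof -
  have h0: "h 0 = 0" using hom(1)[of 0 0] by simp
  have hneg: "h (- x) = - h x" for x using hom(1)[of 0 x] h0 by simp
  have hadd: "h (x + y) = h x + h y" for x y using hom(1)[of x "-y"] hneg by simp
  have h2: "h (x / 2) = h x / 2" for x
  proof -
    have "h x = h (x/2 + x/2)" by simp
    also have "\<dots> = 2 * h (x/2)" unfolding hadd by simp
    finally show ?thesis using char by (simp add: field_simps)
  qed
  have hm: "h ((-1) ^ m * x) = (-1) ^ m * h x" for x by (cases "even m") (auto simp: hneg)
  have hm': "h (x * (-1) ^ m) = (-1) ^ m * h x" for x using hm[of x] by (simp add: mult.commute)
  have 1: "fls_X powi e * inverse (fls_const \<tau>) - fls_X powi (- e) * fls_const \<tau>
      = fls_const (inverse \<tau>) * fls_X_intpow e - fls_const (inverse (inverse \<tau>)) * fls_X_intpow (- e)"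
    by (simp add: fls_inverse_const mult.commute)
  have 2: "inverse fls_X powi e * inverse (fls_const \<tau>) - inverse fls_X powi (- e) * fls_const \<tau>
      = - (fls_const \<tau> * fls_X_intpow e - fls_const (inverse \<tau>) * fls_X_intpow (- e))"
    unfolding inverse_fls_X_powi by (simp add: fls_inverse_const mult.commute)
  have 4: "fls_nth (fls_const c * f) n = c * fls_nth f n" for c :: 'a and f n by simp
  show ?thesis
  proof (cases "e dvd N")
    case True
    then obtain n where n: "N = e * n" by (auto simp: dvd_def)
    then have d: "N div e = n" "(- N) div e = - n" "e dvd - N" using e nonzero_mult_div_cancel_left[of e "- n"] by auto
    show ?thesis
      unfolding sym_exp_def 1 2 inverse_power_minus 4
      using pole_expansion[of h "inverse \<tau>" e m N, OF hom(1,2) _ e]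
        pole_expansion[of h \<tau> e m "-N", OF hom(1,2) t e] t True d
      by (simp add: W_hat_pole h2 hadd hm hm' power_int_inverse power_int_minus add_divide_distrib
          algebra_simps del: add_2_eq_Suc')
  next
    case False
    then have "\<not> e dvd - N" by simp
    then show ?thesis
      unfolding sym_exp_def 1 2 inverse_power_minus 4
      using pole_expansion[of h "inverse \<tau>" e m N, OF hom(1,2) _ e]
        pole_expansion[of h \<tau> e m "-N", OF hom(1,2) t e] t False
      by simp
  qed
qed

section \<open>The symmetric expansion of \<open>f\<^sub>0\<close>\<close>

definition signed_sum :: "'i set \<Rightarrow> ('i \<Rightarrow> 'b::ab_group_add) \<Rightarrow> 'i set \<Rightarrow> 'b" where
  "signed_sum I f X = (\<Sum>i\<in>I. if i \<in> X then f i else - f i)"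

lemma power_int_sum_const:
  "z \<noteq> 0 \<Longrightarrow> (\<Prod>i\<in>S. z powi (f i)) = (z::'a::field) powi (\<Sum>i\<in>S. f i)"
  by (induction S rule: infinite_finite_induct) (auto simp: power_int_add)

text \<open>
  \<open>X\<close> is the set of factors from which the term \<open>- z\<^sup>-\<^sup>b t\<close> is taken, where \<open>b\<close> is the
  corresponding \<open>a_bar\<close>.
\<close>
lemma f0_expand:
  fixes t z :: "'a::field"
  assumes "t \<noteq> 0" "z \<noteq> 0"
  shows "f0 k a t z =
    (\<Sum>X\<in>Pow {1..k}. (-1) ^ card X * t powi (signed_sum {1..k} (\<lambda>_. 1) X)
        * z powi (- signed_sum {1..k} (a_bar k a) X)
        * inverse ((z powi A_prod k a * inverse t - z powi (- A_prod k a) * t) ^ (k - 2)))"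
proof -
  have tm: "(\<Prod>i\<in>X. z powi (- a_bar k a i) * t) * (\<Prod>i\<in>{1..k} - X. z powi a_bar k a i * inverse t)
      = t powi (signed_sum {1..k} (\<lambda>_. 1) X) * z powi (- signed_sum {1..k} (a_bar k a) X)"
    if "X \<in> Pow {1..k}" for X
  proof -
    have s: "signed_sum {1..k} f X = sum f X - sum f ({1..k} - X)" for f :: "nat \<Rightarrow> int"
    proof -
      have "signed_sum {1..k} f X = (\<Sum>i\<in>X. if i \<in> X then f i else - f i)
          + (\<Sum>i\<in>{1..k} - X. if i \<in> X then f i else - f i)"
        unfolding signed_sum_def using that
        by (subst sum.subset_diff[of X "{1..k}"]) (auto simp: add.commute)
      then show ?thesis by (simp add: sum_negf)
    qed
    have p1: "(\<Prod>i\<in>X. z powi (- a_bar k a i) * t) = z powi (- sum (a_bar k a) X) * t powi (\<Sum>i\<in>X. 1)"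
      using assms power_int_sum_const[of z "\<lambda>i. - a_bar k a i" X] power_int_sum_const[of t "\<lambda>i. 1" X]
      by (simp add: prod.distrib sum_negf)
    have p2: "(\<Prod>i\<in>{1..k} - X. z powi a_bar k a i * inverse t)
        = z powi (sum (a_bar k a) ({1..k} - X)) * t powi (- (\<Sum>i\<in>{1..k} - X. 1))"
      using assms power_int_sum_const[of z "\<lambda>i. a_bar k a i" "{1..k} - X"]
        power_int_sum_const[of t "\<lambda>i. -1" "{1..k} - X"]
      by (simp add: prod.distrib power_int_minus)
    have "z powi (- sum (a_bar k a) X) * t powi (\<Sum>i\<in>X. 1)
        * (z powi (sum (a_bar k a) ({1..k} - X)) * t powi (- (\<Sum>i\<in>{1..k} - X. 1)))
      = (t powi (\<Sum>i\<in>X. 1) * t powi (- (\<Sum>i\<in>{1..k} - X. 1)))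
        * (z powi (- sum (a_bar k a) X) * z powi (sum (a_bar k a) ({1..k} - X)))"
      by (simp only: ac_simps)
    also have "\<dots> = t powi (signed_sum {1..k} (\<lambda>_. 1) X) * z powi (- signed_sum {1..k} (a_bar k a) X)"
      by (simp only: power_int_add[OF disjI1[OF assms(1)], symmetric]
          power_int_add[OF disjI1[OF assms(2)], symmetric] s diff_conv_add_uminus minus_add_distrib minus_minus)
    finally show ?thesis unfolding p1 p2 .
  qed
  show ?thesis
    unfolding f0_def divide_inverse prod_diff_conv_sum[OF finite_atLeastAtMost] sum_distrib_right
  proof (rule sum.cong[OF refl])
    fix X assume X: "X \<in> Pow {1..k}"
    let ?I = "inverse ((z powi A_prod k a * inverse t - z powi - A_prod k a * t) ^ (k - 2))"
    show "(-1) ^ card X * (\<Prod>i\<in>X. z powi - a_bar k a i * t)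
          * (\<Prod>i\<in>{1..k} - X. z powi a_bar k a i * inverse t) * ?I
        = (-1) ^ card X * t powi (signed_sum {1..k} (\<lambda>_. 1) X)
          * z powi (- signed_sum {1..k} (a_bar k a) X) * ?I"
      using arg_cong[OF tm[OF X], of "\<lambda>u. (-1) ^ card X * u * ?I"] by (simp only: mult.assoc)
  qed
qed

theorem sym_exp_f0_eq:
  assumes A: "A_prod k a > 0" and k: "k \<ge> 2"
  shows "sym_exp_f0 k a N m =
    (\<Sum>X\<in>Pow {1..k}. if N = - (A_prod k a * (m - signed_sum {1..k} (\<lambda>_. 1) X) + signed_sum {1..k} (a_bar k a) X)
        then (-1) ^ card X * W_hat k (m - signed_sum {1..k} (\<lambda>_. 1) X) else 0)"
proof -
  define A where "A = A_prod k a"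
  define \<sigma> where "\<sigma> = signed_sum {1..k} (\<lambda>_. 1 :: int)"
  define E where "E = signed_sum {1..k} (a_bar k a)"
  define P where "P = (\<lambda>z :: rat fls fls. inverse ((z powi A * inverse (fls_const fls_X) - z powi (- A) * fls_const fls_X) ^ (k - 2)))"
  have exp: "f0 k a (fls_const fls_X) z =
     (\<Sum>X\<in>Pow {1..k}. fls_const ((-1) ^ card X * fls_X powi \<sigma> X) * z powi (- E X) * P z)"
    if "z \<noteq> 0" for z :: "rat fls fls"
    using f0_expand[of "fls_const fls_X" z k a] that
    by (simp add: \<sigma>_def E_def P_def A_def fls_const_power_int fls_const_power
        flip: fls_const_mult_const del: fls_X_power_int)
  have "sym_exp (f0 k a (fls_const fls_X)) N
      = sym_exp (\<lambda>z :: rat fls fls. \<Sum>X\<in>Pow {1..k}. fls_const ((-1) ^ card X * fls_X powi \<sigma> X) * z powi (- E X) * P z) N"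
    unfolding sym_exp_def by (subst (1 2) exp) auto
  also have "\<dots> = (\<Sum>X\<in>Pow {1..k}. (-1) ^ card X * fls_X powi \<sigma> X * sym_exp P (N + E X))"
    unfolding sym_exp_sum sym_exp_monom_times by simp
  finally have main: "sym_exp (f0 k a (fls_const fls_X)) N
      = (\<Sum>X\<in>Pow {1..k}. (-1) ^ card X * fls_X powi \<sigma> X * sym_exp P (N + E X))" .
  have P: "sym_exp P M = (if A dvd M then fls_const (W_hat k (- (M div A))) * fls_X powi (- (M div A)) else 0)" for M
    unfolding P_def using A k
    by (subst sym_exp_pole[where h = fls_const]) (auto simp: A_def Suc_diff_Suc numeral_2_eq_2
        fls_const_mult_const[symmetric] intro: fls_eqI simp del: fls_const_mult_const fls_X_power_int)
  have tm: "fls_nth ((-1) ^ card X * fls_X powi \<sigma> X * sym_exp P (N + E X)) m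
      = (if N = - (A * (m - \<sigma> X) + E X) then (-1) ^ card X * W_hat k (m - \<sigma> X) else 0)" for X
  proof (cases "A dvd N + E X")
    case True
    then obtain d where d: "N + E X = A * d" by (auto simp: dvd_def)
    have A0: "A > 0" using A by (simp add: A_def)
    have eq: "N = - (A * (m - \<sigma> X) + E X) \<longleftrightarrow> m = \<sigma> X - d"
    proof -
      have "N = - (A * (m - \<sigma> X) + E X) \<longleftrightarrow> A * (d + m - \<sigma> X) = 0"
        using d by (auto simp: algebra_simps)
      then show ?thesis using A0 by auto
    qed
    have "(-1) ^ card X * fls_X powi \<sigma> X * sym_exp P (N + E X)
        = fls_const ((-1) ^ card X * W_hat k (- d)) * (fls_X powi \<sigma> X * fls_X powi (- d) :: rat fls)"
      using A0 by (simp add: P d fls_const_power flip: fls_const_mult_const del: fls_X_power_int)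
    also have "\<dots> = fls_const ((-1) ^ card X * W_hat k (- d)) * fls_X_intpow (\<sigma> X - d) * 1"
      by (subst power_int_add[symmetric]) auto
    finally show ?thesis using eq by (simp only: fls_nth_monom_times) auto
  next
    case False
    then have "N \<noteq> - (A * (m - \<sigma> X) + E X)" by auto
    then show ?thesis using False by (simp add: P)
  qed
  show ?thesis
    unfolding sym_exp_f0_def main fls_nth_sum tm unfolding A_def \<sigma>_def E_def ..
qed

section \<open>Determinants triangular with respect to a height\<close>

text \<open>
  The vertices of a plumbing tree are not numbered along the legs, so triangularity is relative to
  a height function. In the Leibniz formula a permutation with nonzero product never lowers the
  height; since it preserves the sum of all heights, it raises none of them and is the identity.
\<close>
lemma det_triangular_wrt_height:
  fixes A :: "'a::comm_ring_1 mat" and h :: "nat \<Rightarrow> nat"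
  assumes A: "A \<in> carrier_mat n n"
    and tri: "\<And>i j. i < n \<Longrightarrow> j < n \<Longrightarrow> A $$ (i, j) \<noteq> 0 \<Longrightarrow> i = j \<or> h i < h j"
  shows "det A = (\<Prod>i<n. A $$ (i, i))"
proof -
  let ?f = "\<lambda>\<pi>. signof \<pi> * (\<Prod>i = 0..<n. A $$ (i, \<pi> i))"
  have "?f \<pi> = 0" if \<pi>: "\<pi> permutes {0..<n}" "\<pi> \<noteq> id" for \<pi>
  proof (rule ccontr)
    assume "?f \<pi> \<noteq> 0"
    then have "A $$ (i, \<pi> i) \<noteq> 0" if "i < n" for i
      using that by (metis atLeastLessThan_iff finite_atLeastLessThan le0 mult_zero_right prod_zero)
    then have up: "i = \<pi> i \<or> h i < h (\<pi> i)" if "i < n" for i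
      using tri[of i "\<pi> i"] permutes_in_image[OF \<pi>(1), of i] that by auto
    obtain i where i: "\<pi> i \<noteq> i" using \<pi>(2) by fastforce
    then have "i < n" using permutes_not_in[OF \<pi>(1), of i] by auto
    then have "(\<Sum>i = 0..<n. h i) < (\<Sum>i = 0..<n. h (\<pi> i))"
    proof (intro sum_strict_mono_ex1)
      show "\<forall>i\<in>{0..<n}. h i \<le> h (\<pi> i)"
        using up by (metis atLeastLessThan_iff less_imp_le order_refl)
      show "\<exists>i\<in>{0..<n}. h i < h (\<pi> i)"
        using up[OF \<open>i < n\<close>] i \<open>i < n\<close> by (intro bexI[of _ i]) auto
    qed simp
    moreover have "(\<Sum>i = 0..<n. h (\<pi> i)) = (\<Sum>i = 0..<n. h i)"
      using sum.permute[OF \<pi>(1), of h] by (simp add: o_def)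
    ultimately show False by simp
  qed
  then have "det A = (\<Sum>\<pi>\<in>{id}. ?f \<pi>)"
    unfolding det_def'[OF A]
    by (intro sum.mono_neutral_right) (auto simp: finite_permutations permutes_id)
  then show ?thesis by (simp add: atLeast0LessThan)
qed

section \<open>Continuants and negative continued fractions\<close>

text \<open>
  The determinant of the tridiagonal matrix with diagonal \<open>cs\<close> and all neighbouring entries \<open>-1\<close>.
  It is the numerator of the negative continued fraction with the entries \<open>cs\<close>.
\<close>
fun continuant :: "int list \<Rightarrow> int" where
  "continuant [] = 1"
| "continuant [c] = c"
| "continuant (c # c' # cs) = c * continuant (c' # cs) - continuant cs"

lemma coprime_continuant: "coprime (continuant (c # cs)) (continuant cs)"
proof (induction cs arbitrary: c)
  case (Cons c' cs)
  show ?case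
  proof (rule coprimeI)
    fix d assume d: "d dvd continuant (c # c' # cs)" "d dvd continuant (c' # cs)"
    have "c * continuant (c' # cs) - continuant (c # c' # cs) = continuant cs" by simp
    then have "d dvd continuant cs" using d by (metis dvd_diff dvd_mult)
    then show "is_unit d" using Cons.IH[of c'] d(2) by (meson coprime_common_divisor)
  qed
qed simp

lemma neg_cont_frac_continuant:
  assumes "\<And>j. j \<le> length cs \<Longrightarrow> continuant (drop j cs) > 0" "cs \<noteq> []"
  shows "neg_cont_frac (map rat_of_int cs) = of_int (continuant cs) / of_int (continuant (tl cs))"
  using assms
proof (induction cs rule: continuant.induct)
  case (3 c c' cs)
  have pos: "continuant (c' # cs) > 0" "continuant cs > 0"
    using "3.prems"(1)[of 1] "3.prems"(1)[of 2] by simp_all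
  have "neg_cont_frac (map rat_of_int (c' # cs)) = of_int (continuant (c' # cs)) / of_int (continuant cs)"
    using "3.IH"(1) "3.prems"(1)[of "Suc j" for j] by simp
  then have "neg_cont_frac (map rat_of_int (c # c' # cs))
      = of_int c - of_int (continuant cs) / of_int (continuant (c' # cs))" by simp
  then show ?case using pos by (simp add: field_simps)
qed simp_all

lemma fraction_lowest_terms_unique:
  assumes "coprime a b" "coprime c d" "a > 0" "c > 0" "d > 0"
    and "of_int a / of_int b = (of_int c / of_int d :: rat)"
  shows "a = c"
proof -
  have "(of_int a / of_int b :: rat) > 0" using assms by simp
  then have b: "b > 0" using assms(3) by (simp add: zero_less_divide_iff)
  have "(of_int (a * d) :: rat) = of_int (c * b)"
    using assms(5,6) b by (simp add: field_simps)
  then have "a * d = c * b" by (simp only: of_int_eq_iff)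
  then show ?thesis
    using coprime_crossproduct_int[of a b c d] assms b by (simp add: mult.commute)
qed

section \<open>Star-shaped plumbing trees\<close>

text \<open>
  The path from the node to the leaf \<open>i\<close> is the list \<open>0 # legs i\<close>. Position \<open>j\<close> on leg \<open>i\<close> is the
  vertex \<open>legs i ! j\<close>; its neighbour towards the node is \<open>(0 # legs i) ! j\<close>, also for \<open>j = 0\<close>.
\<close>
locale star_plumbing =
  fixes \<Gamma> :: plumbing and k :: nat and legs :: "nat \<Rightarrow> nat list"
  assumes nverts_pos: "0 < nverts \<Gamma>"
    and legs_nonempty: "\<And>i. i \<in> {1..k} \<Longrightarrow> legs i \<noteq> []"
    and last_leg: "\<And>i. i \<in> {1..k} \<Longrightarrow> last (legs i) = i"
    and distinct_legs: "distinct (concat (map legs [1..<Suc k]))"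
    and set_legs: "set (concat (map legs [1..<Suc k])) = {1..<nverts \<Gamma>}"
    and adj_iff: "\<And>u v. adj \<Gamma> u v \<longleftrightarrow>
           (\<exists>i \<in> {1..k}. \<exists>j < length (legs i).
              {u, v} = {(0 # legs i) ! j, (0 # legs i) ! Suc j})"
begin

abbreviation "n \<equiv> nverts \<Gamma>"

text \<open>
  The product of the plumbing matrix with a vector, where vectors are functions on the vertices;
  this spares carrier conditions when vectors are given by their values along the legs.
\<close>
definition mrow :: "(nat \<Rightarrow> int) \<Rightarrow> nat \<Rightarrow> int" where
  "mrow y v = (\<Sum>w<n. plumbing_matrix \<Gamma> $$ (v, w) * y w)"

definition positions :: "(nat \<times> nat) set" where
  "positions = (SIGMA i:{1..k}. {..<length (legs i)})"

definition vertex_at :: "nat \<times> nat \<Rightarrow> nat" where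
  "vertex_at = (\<lambda>(i, j). legs i ! j)"

definition leg :: "nat \<Rightarrow> nat" where "leg v = fst (the_inv_into positions vertex_at v)"
definition pos :: "nat \<Rightarrow> nat" where "pos v = snd (the_inv_into positions vertex_at v)"

lemma bij_vertex_at: "bij_betw vertex_at positions {1..<n}"
proof -
  have sub: "distinct (legs i)" if "i \<in> {1..k}" for i
    using distinct_legs that unfolding distinct_concat_iff by (auto simp del: upt_Suc)
  have disj: "i = i'" if "i \<in> {1..k}" "i' \<in> {1..k}" "v \<in> set (legs i)" "v \<in> set (legs i')" for i i' v
  proof (rule ccontr)
    assume "i \<noteq> i'"
    then have "legs i \<noteq> legs i'" using last_leg that by metis
    moreover have "legs i \<in> set (map legs [1..<Suc k])" "legs i' \<in> set (map legs [1..<Suc k])"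
      using that by (auto simp del: upt_Suc)
    ultimately have "set (legs i) \<inter> set (legs i') = {}"
      using distinct_legs unfolding distinct_concat_iff by blast
    then show False using that by auto
  qed
  have "inj_on vertex_at positions"
  proof (rule inj_onI)
    fix x y assume *: "x \<in> positions" "y \<in> positions" "vertex_at x = vertex_at y"
    obtain i j i' j' where xy: "x = (i, j)" "y = (i', j')" by (cases x, cases y) auto
    have "i = i'"
      using * xy by (intro disj[of i i' "legs i ! j"]) (auto simp: positions_def vertex_at_def intro: nth_mem, metis nth_mem)
    then show "x = y"
      using * xy nth_eq_iff_index_eq[OF sub[of i]] by (auto simp: positions_def vertex_at_def)
  qed
  moreover have "vertex_at ` positions = {1..<n}"
    unfolding set_legs[symmetric] by (force simp: positions_def vertex_at_def in_set_conv_nth)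
  ultimately show ?thesis by (simp add: bij_betw_def)
qed

lemma vertex_range: "i \<in> {1..k} \<Longrightarrow> j < length (legs i) \<Longrightarrow> 0 < legs i ! j \<and> legs i ! j < n"
  using bij_betw_apply[OF bij_vertex_at, of "(i, j)"] by (auto simp: positions_def vertex_at_def)

lemma leg_pos_nth [simp]:
  assumes "i \<in> {1..k}" "j < length (legs i)"
  shows "leg (legs i ! j) = i" "pos (legs i ! j) = j"
  using the_inv_into_f_f[of vertex_at positions "(i, j)"] bij_vertex_at assms
  by (auto simp: leg_def pos_def bij_betw_def positions_def vertex_at_def)

lemma leg_pos:
  assumes "0 < v" "v < n"
  shows "leg v \<in> {1..k}" "pos v < length (legs (leg v))" "legs (leg v) ! pos v = v"
proof -
  have "v \<in> vertex_at ` positions" using bij_vertex_at assms by (auto simp: bij_betw_def)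
  then obtain i j where "i \<in> {1..k}" "j < length (legs i)" "v = legs i ! j"
    by (auto simp: positions_def vertex_at_def)
  then show "leg v \<in> {1..k}" "pos v < length (legs (leg v))" "legs (leg v) ! pos v = v" by auto
qed

lemma nth_eq_iff:
  assumes "i \<in> {1..k}" "j < length (legs i)" "i' \<in> {1..k}" "j' < length (legs i')"
  shows "legs i ! j = legs i' ! j' \<longleftrightarrow> i = i' \<and> j = j'"
  using leg_pos_nth[OF assms(1,2)] leg_pos_nth[OF assms(3,4)] by metis

lemma leaf_nth: "i \<in> {1..k} \<Longrightarrow> legs i ! (length (legs i) - 1) = i"
  using legs_nonempty last_leg by (metis last_conv_nth)

lemma path_nth_length: "i \<in> {1..k} \<Longrightarrow> (0 # legs i) ! length (legs i) = i"
  using leaf_nth[of i] legs_nonempty[of i] by (cases "length (legs i)") auto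

lemma adj_node: "adj \<Gamma> 0 w \<longleftrightarrow> (\<exists>i\<in>{1..k}. w = legs i ! 0)"
proof
  assume "adj \<Gamma> 0 w"
  then obtain i j where ij: "i \<in> {1..k}" "j < length (legs i)"
    "{0, w} = {(0 # legs i) ! j, legs i ! j}" by (auto simp: adj_iff)
  then have "legs i ! j \<noteq> 0" using vertex_range by auto
  then have "(0 # legs i) ! j = 0" "w = legs i ! j" using ij(3) by (auto simp: doubleton_eq_iff)
  then have "j = 0" using ij vertex_range[of i "j - 1"] by (cases j) auto
  then show "\<exists>i\<in>{1..k}. w = legs i ! 0" using ij \<open>w = legs i ! j\<close> by auto
next
  assume "\<exists>i\<in>{1..k}. w = legs i ! 0"
  then show "adj \<Gamma> 0 w" unfolding adj_iff using legs_nonempty by force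
qed

lemma adj_leg:
  assumes ij: "i \<in> {1..k}" "j < length (legs i)"
  shows "adj \<Gamma> (legs i ! j) w \<longleftrightarrow>
    w = (0 # legs i) ! j \<or> Suc j < length (legs i) \<and> w = legs i ! Suc j"
proof
  assume "adj \<Gamma> (legs i ! j) w"
  then obtain i' j' where ij': "i' \<in> {1..k}" "j' < length (legs i')"
    "{legs i ! j, w} = {(0 # legs i') ! j', legs i' ! j'}" by (auto simp: adj_iff)
  then consider "legs i ! j = legs i' ! j'" "w = (0 # legs i') ! j'"
    | "legs i ! j = (0 # legs i') ! j'" "w = legs i' ! j'" by (auto simp: doubleton_eq_iff)
  then show "w = (0 # legs i) ! j \<or> Suc j < length (legs i) \<and> w = legs i ! Suc j"
  proof cases
    case 1
    then show ?thesis using nth_eq_iff[OF ij ij'(1,2)] by simp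
  next
    case 2
    then obtain j0 where j0: "j' = Suc j0" using vertex_range[OF ij] by (cases j') auto
    then show ?thesis using 2 nth_eq_iff[OF ij ij'(1), of j0] ij'(2) by auto
  qed
next
  assume "w = (0 # legs i) ! j \<or> Suc j < length (legs i) \<and> w = legs i ! Suc j"
  then show "adj \<Gamma> (legs i ! j) w"
  proof
    assume "w = (0 # legs i) ! j"
    then show ?thesis unfolding adj_iff using ij by (auto intro!: bexI[of _ i] exI[of _ j])
  next
    assume "Suc j < length (legs i) \<and> w = legs i ! Suc j"
    then show ?thesis unfolding adj_iff using ij by (auto intro!: bexI[of _ i] exI[of _ "Suc j"])
  qed
qed

lemma path_neq:
  assumes "i \<in> {1..k}" "j < length (legs i)"
  shows "(0 # legs i) ! j \<noteq> legs i ! j" "Suc j < length (legs i) \<Longrightarrow> legs i ! Suc j \<noteq> legs i ! j"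
    "Suc j < length (legs i) \<Longrightarrow> legs i ! Suc j \<noteq> (0 # legs i) ! j" "(0 # legs i) ! j < n"
  using assms vertex_range[of i] nverts_pos
  by (cases j; auto simp: nth_eq_iff; metis)+

lemma adj_irrefl: "\<not> adj \<Gamma> v v"
proof
  assume "adj \<Gamma> v v"
  then obtain i j where "i \<in> {1..k}" "j < length (legs i)" "{v, v} = {(0 # legs i) ! j, legs i ! j}"
    by (auto simp: adj_iff)
  then show False using path_neq(1)[of i j] by auto
qed

lemma adj_sym: "adj \<Gamma> u v \<longleftrightarrow> adj \<Gamma> v u"
  unfolding adj_iff by (simp add: insert_commute)

lemma inj_leg_starts: "inj_on (\<lambda>i. legs i ! 0) {1..k}"
  using legs_nonempty by (intro inj_onI) (simp add: nth_eq_iff)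

lemma neighbours_node: "{w. w < n \<and> adj \<Gamma> 0 w} = (\<lambda>i. legs i ! 0) ` {1..k}"
  using vertex_range[of _ 0] legs_nonempty by (auto simp: adj_node)

lemma neighbours_leg:
  assumes "i \<in> {1..k}" "j < length (legs i)"
  shows "{w. w < n \<and> adj \<Gamma> (legs i ! j) w} =
    insert ((0 # legs i) ! j) (if Suc j < length (legs i) then {legs i ! Suc j} else {})"
  using vertex_range[of i] path_neq[OF assms] assms by (auto simp: adj_leg)

lemma deg_node: "deg \<Gamma> 0 = k"
  unfolding deg_def neighbours_node using card_image[OF inj_leg_starts] by simp

lemma deg_leaf: "i \<in> {1..k} \<Longrightarrow> deg \<Gamma> i = 1"
  using neighbours_leg[of i "length (legs i) - 1"] legs_nonempty[of i] leaf_nth[of i]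
  by (simp add: deg_def)

lemma leaf_iff: "i \<in> {1..k} \<Longrightarrow> j < length (legs i) \<Longrightarrow> legs i ! j \<in> {1..k} \<longleftrightarrow> Suc j = length (legs i)"
proof -
  assume ij: "i \<in> {1..k}" "j < length (legs i)"
  show ?thesis
  proof
    assume l: "legs i ! j \<in> {1..k}"
    then have "legs i ! j = legs (legs i ! j) ! (length (legs (legs i ! j)) - 1)" using leaf_nth by simp
    then show "Suc j = length (legs i)"
      using nth_eq_iff[OF ij l, of "length (legs (legs i ! j)) - 1"] legs_nonempty[OF l] ij by auto
  next
    assume "Suc j = length (legs i)"
    then have "j = length (legs i) - 1" by simp
    then show "legs i ! j \<in> {1..k}" using leaf_nth ij by simp
  qed
qed

lemma deg_joint: "k < v \<Longrightarrow> v < n \<Longrightarrow> deg \<Gamma> v = 2"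
proof -
  assume v: "k < v" "v < n"
  then have v0: "0 < v" by simp
  note lp = leg_pos[OF v0 v(2)]
  have "Suc (pos v) < length (legs (leg v))"
    using leaf_iff[OF lp(1,2)] lp v by auto
  then show ?thesis
    using neighbours_leg[OF lp(1,2)] path_neq(3)[OF lp(1,2)] lp(3) by (simp add: deg_def)
qed

lemma k_less: "k < n"
  using leaf_nth[of k] vertex_range[of k "length (legs k) - 1"] legs_nonempty[of k] nverts_pos
  by (cases "k = 0") auto

lemma row_neighbours:
  assumes "v < n"
  shows "mrow y v = wt \<Gamma> v * y v + (\<Sum>w | w < n \<and> adj \<Gamma> v w. y w)"
proof -
  have "mrow y v = (\<Sum>w<n. (if w = v then wt \<Gamma> v * y v else 0) + (if adj \<Gamma> v w then y w else 0))"
    unfolding mrow_def using assms by (intro sum.cong) (auto simp: plumbing_matrix_def adj_irrefl)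
  also have "\<dots> = wt \<Gamma> v * y v + (\<Sum>w<n. if adj \<Gamma> v w then y w else 0)"
    using assms by (simp add: sum.distrib)
  also have "(\<Sum>w<n. if adj \<Gamma> v w then y w else 0) = (\<Sum>w | w < n \<and> adj \<Gamma> v w. y w)"
    using sum.inter_filter[of "{..<n}" y "adj \<Gamma> v"] by simp
  finally show ?thesis .
qed

lemma row_leg:
  assumes "i \<in> {1..k}" "j < length (legs i)"
  shows "mrow y (legs i ! j) = wt \<Gamma> (legs i ! j) * y (legs i ! j) + y ((0 # legs i) ! j)
    + (if Suc j < length (legs i) then y (legs i ! Suc j) else 0)"
  unfolding row_neighbours[OF conjunct2[OF vertex_range[OF assms]]] neighbours_leg[OF assms]
  using path_neq(3)[OF assms] by (cases "Suc j < length (legs i)") auto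

lemma row_symmetric: "(\<Sum>v<n. x v * mrow y v) = (\<Sum>v<n. mrow x v * y v)"
proof -
  have "(\<Sum>v<n. x v * mrow y v) = (\<Sum>v<n. \<Sum>w<n. x v * (plumbing_matrix \<Gamma> $$ (v, w) * y w))"
    by (simp add: mrow_def sum_distrib_left)
  also have "\<dots> = (\<Sum>w<n. \<Sum>v<n. x v * (plumbing_matrix \<Gamma> $$ (v, w) * y w))" by (rule sum.swap)
  also have "\<dots> = (\<Sum>w<n. mrow x w * y w)"
    unfolding mrow_def sum_distrib_right
    by (intro sum.cong refl) (auto simp: plumbing_matrix_def adj_sym)
  finally show ?thesis .
qed

section \<open>Elimination along the legs\<close>

text \<open>
  The value 0 beyond the end of the leg makes the three-term recursion hold at the leaf as well.
\<close>
definition tail_cont :: "nat \<Rightarrow> nat \<Rightarrow> int" where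
  "tail_cont i j = (if j \<le> length (legs i) then continuant (drop j (map (\<lambda>v. - wt \<Gamma> v) (legs i))) else 0)"

lemma tail_cont_length: "tail_cont i (length (legs i)) = 1" by (simp add: tail_cont_def)

lemma tail_cont_rec:
  assumes "j < length (legs i)"
  shows "wt \<Gamma> (legs i ! j) * tail_cont i (Suc j) + tail_cont i j + tail_cont i (Suc (Suc j)) = 0"
proof -
  let ?cs = "map (\<lambda>v. - wt \<Gamma> v) (legs i)"
  have d: "drop j ?cs = - wt \<Gamma> (legs i ! j) # drop (Suc j) ?cs"
    using assms by (simp add: Cons_nth_drop_Suc[symmetric] drop_map)
  show ?thesis
  proof (cases "Suc j < length (legs i)")
    case True
    then have d': "drop (Suc j) ?cs = - wt \<Gamma> (legs i ! Suc j) # drop (Suc (Suc j)) ?cs"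
      by (simp add: Cons_nth_drop_Suc[symmetric] drop_map)
    show ?thesis unfolding tail_cont_def d d' using True by simp
  next
    case False
    then have "Suc j = length (legs i)" using assms by simp
    then show ?thesis unfolding tail_cont_def d by simp
  qed
qed

text \<open>
  Starting at the leaf, the equations of the leg determine all values from the one at the leaf,
  by the recursion of the tail continuants. At \<open>j = 0\<close> this relates the node to the leaf.
\<close>
lemma solve_along_leg:
  assumes i: "i \<in> {1..k}" and zero: "\<And>j. j < length (legs i) \<Longrightarrow> mrow y (legs i ! j) = 0"
    and "j \<le> length (legs i)"
  shows "y ((0 # legs i) ! j) = tail_cont i j * y i"
  using assms(3)
proof (induction "length (legs i) - j" arbitrary: j rule: less_induct)
  case less
  show ?case
  proof (cases "j = length (legs i)")
    case True
    then show ?thesis using path_nth_length[OF i] by (simp add: tail_cont_length)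
  next
    case False
    then have j: "j < length (legs i)" using less.prems by simp
    have 1: "y (legs i ! j) = tail_cont i (Suc j) * y i" using less.hyps[of "Suc j"] j by simp
    have 2: "(if Suc j < length (legs i) then y (legs i ! Suc j) else 0) = tail_cont i (Suc (Suc j)) * y i"
      using less.hyps[of "Suc (Suc j)"] j by (auto simp: tail_cont_def)
    have "wt \<Gamma> (legs i ! j) * (tail_cont i (Suc j) * y i) + y ((0 # legs i) ! j) + tail_cont i (Suc (Suc j)) * y i = 0"
      using zero[OF j] unfolding row_leg[OF i j] 1 2 .
    moreover have "(wt \<Gamma> (legs i ! j) * tail_cont i (Suc j) + tail_cont i j + tail_cont i (Suc (Suc j))) * y i = 0"
      using tail_cont_rec[OF j] by simp
    ultimately show ?thesis by (simp add: algebra_simps)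
  qed
qed

text \<open>
  The elimination vector of the vertex at position \<open>j\<close> of leg \<open>i\<close>. It is supported on the part of
  the leg from this vertex outwards, and \<open>M\<close> annihilates it at all later positions.
\<close>
definition branch :: "nat \<Rightarrow> nat \<Rightarrow> nat \<Rightarrow> int" where
  "branch i j v = (if 0 < v \<and> leg v = i \<and> j \<le> pos v then tail_cont i (Suc (pos v)) else 0)"

lemma row_branch:
  assumes ij: "i \<in> {1..k}" "j < length (legs i)" and ij': "i' \<in> {1..k}" "j' < length (legs i')"
    and "j \<le> j'"
  shows "mrow (branch i j) (legs i' ! j') = (if i' = i \<and> j' = j then - tail_cont i j else 0)"
proof (cases "i' = i")
  case False
  have "branch i j ((0 # legs i') ! j') = 0"
    using False ij' by (cases j') (auto simp: branch_def)
  then show ?thesis using False ij' by (simp add: row_leg branch_def)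
next
  case True
  have 1: "branch i j (legs i ! j') = tail_cont i (Suc j')"
    using True ij' assms(5) vertex_range[OF ij'] by (simp add: branch_def)
  have 2: "branch i j ((0 # legs i) ! j') = (if j' = j then 0 else tail_cont i j')"
    using True ij' assms(5) vertex_range[of i "j' - 1"] by (cases j') (auto simp: branch_def)
  have 3: "(if Suc j' < length (legs i) then branch i j (legs i ! Suc j') else 0) = tail_cont i (Suc (Suc j'))"
    using True ij' assms(5) vertex_range[of i "Suc j'"] by (auto simp: branch_def tail_cont_def)
  show ?thesis
    using row_leg[OF ij', of "branch i j"] tail_cont_rec[OF ij'(2)] unfolding True 1 2 3 by auto
qed

definition leg_prod_except :: "nat \<Rightarrow> int" where "leg_prod_except i = (\<Prod>i'\<in>{1..k} - {i}. tail_cont i' 0)"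
definition leg_prod :: int where "leg_prod = (\<Prod>i\<in>{1..k}. tail_cont i 0)"

lemma leg_prod_except: "i \<in> {1..k} \<Longrightarrow> leg_prod = tail_cont i 0 * leg_prod_except i"
  unfolding leg_prod_def leg_prod_except_def by (rule prod.remove) auto

text \<open>
  The elimination vector of the node. It is scaled to be integral, with \<open>A\<close> as its value at the
  node and \<open>A/a\<^sub>i\<close> at the leaf \<open>i\<close>, and \<open>M\<close> maps it to a multiple of the unit vector of the node.
\<close>
definition trunk :: "nat \<Rightarrow> int" where
  "trunk v = (if v = 0 then leg_prod else leg_prod_except (leg v) * tail_cont (leg v) (Suc (pos v)))"

text \<open>
  This is \<open>A b - \<Sum>\<^sub>i \<beta>\<^sub>i A/a\<^sub>i\<close>, where \<open>-b\<close> is the weight of the node and \<open>a\<^sub>i\<close>, \<open>\<beta>\<^sub>i\<close> are the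
  first two tail continuants of leg \<open>i\<close>. If the plumbing matrix is negative definite, it is the order of \<open>H\<^sub>1\<close>
  (\<open>homology_order_eq\<close>).
\<close>
definition ordH :: int where "ordH = - mrow trunk 0"

lemma row_trunk:
  assumes "v < n"
  shows "mrow trunk v = (if v = 0 then - ordH else 0)"
proof (cases "v = 0")
  case False
  then have v: "0 < v" by simp
  note lp = leg_pos[OF v assms]
  define i j where "i = leg v" "j = pos v"
  have ij: "i \<in> {1..k}" "j < length (legs i)" "legs i ! j = v" using lp by (auto simp: i_j_def)
  have 1: "trunk (legs i ! j) = leg_prod_except i * tail_cont i (Suc j)"
    using vertex_range[OF ij(1,2)] ij(1,2) by (simp add: trunk_def)
  have 2: "trunk ((0 # legs i) ! j) = leg_prod_except i * tail_cont i j"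
    using leg_prod_except[OF ij(1)] vertex_range[of i "j - 1"] ij(1,2) by (cases j) (auto simp: trunk_def)
  have 3: "(if Suc j < length (legs i) then trunk (legs i ! Suc j) else 0) = leg_prod_except i * tail_cont i (Suc (Suc j))"
    using vertex_range[of i "Suc j"] ij(1,2) by (auto simp: trunk_def tail_cont_def)
  have "mrow trunk v = leg_prod_except i * (wt \<Gamma> (legs i ! j) * tail_cont i (Suc j) + tail_cont i j + tail_cont i (Suc (Suc j)))"
    using row_leg[OF ij(1,2), of trunk] 1 unfolding 2 3 ij(3) by (simp add: algebra_simps)
  then show ?thesis using tail_cont_rec[OF ij(2)] False by simp
qed (simp add: ordH_def)

lemma trunk_leaf: "i \<in> {1..k} \<Longrightarrow> trunk i = leg_prod_except i"
proof -
  assume i: "i \<in> {1..k}"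
  define j where "j = length (legs i) - 1"
  have j: "j < length (legs i)" "Suc j = length (legs i)" "legs i ! j = i"
    using legs_nonempty[OF i] leaf_nth[OF i] by (auto simp: j_def)
  have "leg i = i" "pos i = j" using leg_pos_nth[OF i j(1)] by (simp_all add: j(3))
  then show ?thesis using i j(2) by (simp add: trunk_def tail_cont_length)
qed

lemma prod_vertices: "(\<Prod>v\<in>{1..<n}. f (leg v) (pos v)) = (\<Prod>i\<in>{1..k}. \<Prod>j<length (legs i). f i j)"
proof -
  have "(\<Prod>v\<in>{1..<n}. f (leg v) (pos v))
      = (\<Prod>x\<in>positions. f (leg (vertex_at x)) (pos (vertex_at x)))"
    using prod.reindex_bij_betw[OF bij_vertex_at, of "\<lambda>v. f (leg v) (pos v)"] by simp
  also have "\<dots> = (\<Prod>(i, j)\<in>positions. f i j)"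
    by (rule prod.cong) (auto simp: positions_def vertex_at_def)
  also have "\<dots> = (\<Prod>i\<in>{1..k}. \<Prod>j<length (legs i). f i j)"
    unfolding positions_def by (rule prod.Sigma[symmetric]) auto
  finally show ?thesis .
qed

end

section \<open>Determinant and inverse of the plumbing matrix\<close>

locale negative_star_plumbing = star_plumbing +
  assumes neg_def: "\<And>x v. v < n \<Longrightarrow> x v \<noteq> 0 \<Longrightarrow> (\<Sum>v<n. x v * mrow x v) < 0"
begin

text \<open>
  The quadratic form takes the value \<open>- tail_cont i (Suc j) * tail_cont i j\<close> at the elimination
  vector of position \<open>j\<close>, so consecutive tail continuants have the same sign. The last one is 1.
\<close>
lemma tail_cont_positive:
  assumes i: "i \<in> {1..k}" and "j \<le> length (legs i)"
  shows "tail_cont i j > 0"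
  using assms(2)
proof (induction rule: inc_induct)
  case base
  show ?case by (simp add: tail_cont_length)
next
  case (step j)
  define v where "v = legs i ! j"
  have v: "0 < v" "v < n" "leg v = i" "pos v = j"
    using vertex_range[OF i step(2)] leg_pos_nth[OF i step(2)] by (simp_all add: v_def)
  have b: "branch i j v = tail_cont i (Suc j)" using v by (simp add: branch_def)
  have "branch i j w * mrow (branch i j) w = (if w = v then - (tail_cont i (Suc j) * tail_cont i j) else 0)"
    if w: "w < n" for w
  proof (cases "0 < w \<and> leg w = i \<and> j \<le> pos w")
    case True
    have lw: "pos w < length (legs i)" "legs i ! pos w = w" using leg_pos[of w] True w by auto
    then have "mrow (branch i j) w = (if pos w = j then - tail_cont i j else 0)"
      using row_branch[OF i step(2) i lw(1)] True by simp
    moreover have "w = v \<longleftrightarrow> pos w = j" using lw v v_def by auto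
    ultimately show ?thesis using b by auto
  next
    case False
    then show ?thesis using v by (auto simp: branch_def)
  qed
  then have "(\<Sum>w<n. branch i j w * mrow (branch i j) w) = - (tail_cont i (Suc j) * tail_cont i j)"
    using v by simp
  moreover have "(\<Sum>w<n. branch i j w * mrow (branch i j) w) < 0"
    using v b step.IH by (intro neg_def[of v]) auto
  ultimately show ?case using step.IH by (simp add: zero_less_mult_iff)
qed

lemma leg_prod_positive: "leg_prod > 0"
  unfolding leg_prod_def using tail_cont_positive by (intro prod_pos) auto

lemma ordH_positive: "ordH > 0"
proof -
  have "(\<Sum>w<n. trunk w * mrow trunk w) = (\<Sum>w<n. if w = 0 then - (leg_prod * ordH) else 0)"
    by (rule sum.cong) (auto simp: row_trunk trunk_def)
  then have "(\<Sum>w<n. trunk w * mrow trunk w) = - (leg_prod * ordH)"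
    using nverts_pos by simp
  moreover have "(\<Sum>w<n. trunk w * mrow trunk w) < 0"
    using leg_prod_positive nverts_pos by (intro neg_def[of 0]) (auto simp: trunk_def)
  ultimately show ?thesis using leg_prod_positive by (simp add: zero_less_mult_iff)
qed

lemma plumbing_matrix_carrier: "plumbing_matrix \<Gamma> \<in> carrier_mat n n"
  by (simp add: plumbing_matrix_def)

text \<open>
  The elimination vectors are the columns of a matrix \<open>P\<close>. With respect to the distance from the
  node, \<open>P\<close> and \<open>M P\<close> are triangular in opposite directions. Apart from the entry
  \<open>- ordH\<close> of \<open>M P\<close> at the node, the diagonals consist of tail continuants and their products up to
  sign, and the quotient of the two determinants telescopes along each leg.
\<close>
lemma det_plumbing_matrix: "det (plumbing_matrix \<Gamma>) = (-1) ^ n * ordH"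
proof -
  let ?M = "plumbing_matrix \<Gamma>"
  define P where "P = mat n n (\<lambda>(v, w). if w = 0 then trunk v else branch (leg w) (pos w) v)"
  define h where "h v = (if v = 0 then 0 else Suc (pos v))" for v
  have P: "P \<in> carrier_mat n n" by (simp add: P_def)
  have MP: "?M * P \<in> carrier_mat n n" using plumbing_matrix_carrier P by simp
  have MP_entry: "(?M * P) $$ (v, w) = mrow (\<lambda>v. P $$ (v, w)) v" if "v < n" "w < n" for v w
    using that plumbing_matrix_carrier P
    by (auto simp: scalar_prod_def mrow_def atLeast0LessThan intro!: sum.cong)
  have row_P: "mrow (\<lambda>v. P $$ (v, w)) v = mrow (if w = 0 then trunk else branch (leg w) (pos w)) v" if "w < n" for v w
    unfolding mrow_def using that by (intro sum.cong) (auto simp: P_def)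
  have MP_entry': "(?M * P) $$ (v, w) = (if w = 0 then if v = 0 then - ordH else 0
      else if v = w then - tail_cont (leg w) (pos w) else 0)"
    if "v < n" "w < n" "h w \<le> h v" for v w
  proof (cases "w = 0")
    case True
    then show ?thesis using that by (simp add: MP_entry row_P row_trunk)
  next
    case False
    then have "0 < w" "0 < v" using that by (auto simp: h_def split: if_splits)
    note lw = leg_pos[OF \<open>0 < w\<close> that(2)] and lv = leg_pos[OF \<open>0 < v\<close> that(1)]
    have "pos w \<le> pos v" using that \<open>0 < w\<close> \<open>0 < v\<close> by (simp add: h_def)
    then have "mrow (branch (leg w) (pos w)) v = (if leg v = leg w \<and> pos v = pos w then - tail_cont (leg w) (pos w) else 0)"
      using row_branch[OF lw(1,2) lv(1,2)] lv(3) by simp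
    moreover have "leg v = leg w \<and> pos v = pos w \<longleftrightarrow> v = w" using lv lw by metis
    ultimately show ?thesis using that False by (simp add: MP_entry row_P)
  qed
  have split: "{..<n} = insert 0 {1..<n}" using nverts_pos by auto
  have "det (?M * P) = (\<Prod>v<n. (?M * P) $$ (v, v))"
  proof (rule det_triangular_wrt_height[OF MP, of h])
    fix v w assume vw: "v < n" "w < n" "(?M * P) $$ (v, w) \<noteq> 0"
    show "v = w \<or> h v < h w"
      using MP_entry'[OF vw(1,2)] vw(3) by (cases "h w \<le> h v") (auto split: if_splits)
  qed
  also have "\<dots> = - ordH * (\<Prod>v\<in>{1..<n}. - tail_cont (leg v) (pos v))"
    unfolding split using nverts_pos by (simp add: MP_entry')
  also have "(\<Prod>v\<in>{1..<n}. - tail_cont (leg v) (pos v)) = (-1) ^ (n - 1) * (\<Prod>v\<in>{1..<n}. tail_cont (leg v) (pos v))"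
    using prod.distrib[of "\<lambda>_. -1" "\<lambda>v. tail_cont (leg v) (pos v)" "{1..<n}"] by simp
  finally have dMP: "det (?M * P) = - ordH * ((-1) ^ (n - 1) * (\<Prod>v\<in>{1..<n}. tail_cont (leg v) (pos v)))" .
  define X where "X = (\<Prod>v\<in>{1..<n}. tail_cont (leg v) (Suc (pos v)))"
  have "det P = det (transpose_mat P)" using det_transpose[OF P] by simp
  also have "\<dots> = (\<Prod>v<n. transpose_mat P $$ (v, v))"
  proof (rule det_triangular_wrt_height[of _ _ h])
    fix w v assume "w < n" "v < n" "transpose_mat P $$ (w, v) \<noteq> 0"
    then have wv: "w < n" "v < n" "P $$ (v, w) \<noteq> 0" using P by auto
    show "w = v \<or> h w < h v"
    proof (cases "w = 0 \<or> v = 0")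
      case True
      then show ?thesis using wv by (auto simp: P_def h_def branch_def split: if_splits)
    next
      case False
      then have e: "leg v = leg w" "pos w \<le> pos v" using wv by (auto simp: P_def branch_def split: if_splits)
      have "legs (leg w) ! pos w = w" "legs (leg v) ! pos v = v"
        using False wv by (auto intro: leg_pos(3))
      then have "w = v" if "pos w = pos v" using e that by simp
      then show ?thesis using e False by (cases "pos w = pos v") (auto simp: h_def)
    qed
  qed (use P in auto)
  also have "\<dots> = (\<Prod>v<n. P $$ (v, v))" using P by (intro prod.cong) auto
  (* At position j of leg i, P has the diagonal entry tail_cont i (Suc j), and M P has - tail_cont i j. *)
  also have "\<dots> = leg_prod * X"
    unfolding split X_def by (auto simp: P_def branch_def trunk_def nverts_pos intro!: prod.cong arg_cong2[of _ _ _ _ "(*)"])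
  finally have dP: "det P = leg_prod * X" .
  have "X = (\<Prod>i\<in>{1..k}. \<Prod>j<length (legs i). tail_cont i (Suc j))"
    unfolding X_def by (rule prod_vertices)
  moreover have "(\<Prod>v\<in>{1..<n}. tail_cont (leg v) (pos v)) = (\<Prod>i\<in>{1..k}. \<Prod>j<length (legs i). tail_cont i j)"
    by (rule prod_vertices)
  moreover have "(\<Prod>j<length (legs i). tail_cont i j) = tail_cont i 0 * (\<Prod>j<length (legs i). tail_cont i (Suc j))" for i
  proof -
    have "(\<Prod>j<length (legs i). tail_cont i j) = (\<Prod>j<Suc (length (legs i)). tail_cont i j)" by (simp add: tail_cont_length)
    also have "\<dots> = tail_cont i 0 * (\<Prod>j<length (legs i). tail_cont i (Suc j))" by (rule prod.lessThan_Suc_shift)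
    finally show ?thesis .
  qed
  ultimately have tele: "(\<Prod>v\<in>{1..<n}. tail_cont (leg v) (pos v)) = leg_prod * X"
    by (simp add: leg_prod_def prod.distrib)
  have "X > 0" unfolding X_def using leg_pos by (intro prod_pos ballI tail_cont_positive) (auto simp: Suc_le_eq)
  have "det ?M * (leg_prod * X) = - ordH * (-1) ^ (n - 1) * (leg_prod * X)"
    using det_mult[OF plumbing_matrix_carrier P] dMP dP tele by simp
  moreover have "leg_prod * X \<noteq> 0" using \<open>X > 0\<close> leg_prod_positive by simp
  ultimately have "det ?M = - ordH * (-1) ^ (n - 1)" using mult_right_cancel by blast
  also have "\<dots> = (-1) ^ n * ordH" using nverts_pos by (cases n) auto
  finally show ?thesis .
qed

lemma homology_order_eq: "homology_order \<Gamma> = ordH"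
  using ordH_positive by (simp add: homology_order_def det_plumbing_matrix abs_mult)

lemma M_prime_carrier: "M_prime \<Gamma> \<in> carrier_mat n n"
  using adj_mat(1)[OF plumbing_matrix_carrier] by (simp add: M_prime_def)

lemma M_mult_M_prime: "plumbing_matrix \<Gamma> * M_prime \<Gamma> = ordH \<cdot>\<^sub>m 1\<^sub>m n"
proof -
  have "plumbing_matrix \<Gamma> * M_prime \<Gamma> = (-1) ^ n \<cdot>\<^sub>m (plumbing_matrix \<Gamma> * adj_mat (plumbing_matrix \<Gamma>))"
    unfolding M_prime_def
    by (rule mult_smult_distrib[OF plumbing_matrix_carrier adj_mat(1)[OF plumbing_matrix_carrier]])
  also have "\<dots> = ordH \<cdot>\<^sub>m 1\<^sub>m n"
    unfolding adj_mat(2)[OF plumbing_matrix_carrier] det_plumbing_matrix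
    by (intro eq_matI) (auto simp flip: power_add mult.assoc)
  finally show ?thesis .
qed

lemma row_M_prime:
  assumes "v < n" "w < n"
  shows "mrow (\<lambda>v. M_prime \<Gamma> $$ (v, w)) v = (if v = w then ordH else 0)"
proof -
  have "mrow (\<lambda>v. M_prime \<Gamma> $$ (v, w)) v = (plumbing_matrix \<Gamma> * M_prime \<Gamma>) $$ (v, w)"
    using assms plumbing_matrix_carrier M_prime_carrier
    by (auto simp: scalar_prod_def mrow_def atLeast0LessThan intro!: sum.cong)
  then show ?thesis using assms by (simp add: M_mult_M_prime)
qed

text \<open>
  Pair the trunk vector with a column of \<open>M'\<close> by the symmetric form \<open>M\<close> and evaluate the result in
  both ways: \<open>M\<close> maps either vector to a multiple of a unit vector.
\<close>
lemma M_prime_node_row: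
  assumes "w < n"
  shows "M_prime \<Gamma> $$ (0, w) = - trunk w"
proof -
  let ?y = "\<lambda>v. M_prime \<Gamma> $$ (v, w)"
  have "(\<Sum>v<n. trunk v * mrow ?y v) = (\<Sum>v<n. if v = w then trunk w * ordH else 0)"
    using assms by (intro sum.cong) (auto simp: row_M_prime)
  moreover have "(\<Sum>v<n. mrow trunk v * ?y v) = (\<Sum>v<n. if v = 0 then - (ordH * ?y 0) else 0)"
    by (intro sum.cong) (auto simp: row_trunk)
  ultimately have "trunk w * ordH = - (ordH * ?y 0)"
    using row_symmetric[of trunk ?y] assms nverts_pos by simp
  then have "ordH * (?y 0 + trunk w) = 0" by (simp add: algebra_simps)
  then show ?thesis using ordH_positive by simp
qed

text \<open>
  A column of \<open>M'\<close> that does not belong to leg \<open>i\<close> solves the homogeneous equations along this leg.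
\<close>
lemma M_prime_leaf_row:
  assumes i: "i \<in> {1..k}" and w: "w < n" "leg w \<noteq> i \<or> w = 0"
  shows "tail_cont i 0 * M_prime \<Gamma> $$ (i, w) = - trunk w"
proof -
  have "mrow (\<lambda>v. M_prime \<Gamma> $$ (v, w)) (legs i ! j) = 0" if j: "j < length (legs i)" for j
    using vertex_range[OF i j] w leg_pos_nth[OF i j] by (auto simp: row_M_prime)
  then show ?thesis
    using solve_along_leg[OF i, of "\<lambda>v. M_prime \<Gamma> $$ (v, w)" 0] M_prime_node_row[OF w(1)] by simp
qed

end

section \<open>Vectors of integers and the plumbing matrix\<close>

lemma finite_vecs_with_entries:
  assumes "finite S"
  shows "finite {v \<in> carrier_vec n. \<forall>i<n. vec_index v i \<in> S}"
proof (rule finite_subset)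
  show "{v \<in> carrier_vec n. \<forall>i<n. vec_index v i \<in> S} \<subseteq> vec n ` ({..<n} \<rightarrow>\<^sub>E S)"
  proof
    fix v assume v: "v \<in> {v \<in> carrier_vec n. \<forall>i<n. vec_index v i \<in> S}"
    then have "v = vec n (restrict (vec_index v) {..<n})" by (intro eq_vecI) auto
    moreover have "restrict (vec_index v) {..<n} \<in> {..<n} \<rightarrow>\<^sub>E S" using v by auto
    ultimately show "v \<in> vec n ` ({..<n} \<rightarrow>\<^sub>E S)" by blast
  qed
  show "finite (vec n ` ({..<n} \<rightarrow>\<^sub>E S))" using assms by (intro finite_imageI finite_PiE) auto
qed

context negative_star_plumbing
begin

abbreviation "M \<equiv> plumbing_matrix \<Gamma>"
abbreviation "M' \<equiv> M_prime \<Gamma>"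
abbreviation "u \<equiv> uvec \<Gamma>"

lemmas M_carrier [simp, intro] = plumbing_matrix_carrier
lemmas M'_carrier [simp, intro] = M_prime_carrier

lemma u_carrier [simp, intro]: "u \<in> carrier_vec n" by (simp add: uvec_def)

lemma M_vec_carrier [simp]: "M *\<^sub>v x \<in> carrier_vec n"
  by (rule carrier_vecI) (simp add: plumbing_matrix_def)

lemma dims [simp]: "dim_row M = n" "dim_col M = n" "dim_row M' = n" "dim_col M' = n" "dim_vec u = n"
  using M_carrier M'_carrier u_carrier by (blast dest: carrier_matD carrier_vecD)+

lemma M'_mult_M: "M' * M = ordH \<cdot>\<^sub>m 1\<^sub>m n"
proof -
  have "M' * M = (-1) ^ n \<cdot>\<^sub>m (adj_mat M * M)"
    unfolding M_prime_def
    by (rule mult_smult_assoc_mat[OF adj_mat(1)[OF M_carrier] M_carrier])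
  also have "\<dots> = ordH \<cdot>\<^sub>m 1\<^sub>m n"
    unfolding adj_mat(3)[OF M_carrier] det_plumbing_matrix
    by (intro eq_matI) (auto simp flip: power_add mult.assoc)
  finally show ?thesis .
qed

lemma smult_one_mult_vec: "x \<in> carrier_vec n \<Longrightarrow> (ordH \<cdot>\<^sub>m 1\<^sub>m n) *\<^sub>v x = ordH \<cdot>\<^sub>v x"
proof (rule eq_vecI)
  fix i assume x: "x \<in> carrier_vec n" and "i < dim_vec (ordH \<cdot>\<^sub>v x)"
  then have i: "i < n" by simp
  have "(\<Sum>j = 0..<n. ordH * (if j = i then 1 else 0) * vec_index x j)
      = (\<Sum>j = 0..<n. if j = i then ordH * vec_index x i else 0)"
    by (rule sum.cong) auto
  then show "vec_index ((ordH \<cdot>\<^sub>m 1\<^sub>m n) *\<^sub>v x) i = vec_index (ordH \<cdot>\<^sub>v x) i"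
    using x i by (simp add: scalar_prod_def)
qed auto

lemma M'_M_vec: "x \<in> carrier_vec n \<Longrightarrow> M' *\<^sub>v (M *\<^sub>v x) = ordH \<cdot>\<^sub>v x"
  using M'_mult_M smult_one_mult_vec assoc_mult_mat_vec[OF M'_carrier M_carrier, of x] by simp

lemma M_M'_vec: "x \<in> carrier_vec n \<Longrightarrow> M *\<^sub>v (M' *\<^sub>v x) = ordH \<cdot>\<^sub>v x"
  using M_mult_M_prime smult_one_mult_vec assoc_mult_mat_vec[OF M_carrier M'_carrier, of x] by simp

lemma M_vec_index: "x \<in> carrier_vec n \<Longrightarrow> v < n \<Longrightarrow> vec_index (M *\<^sub>v x) v = mrow (vec_index x) v"
  by (auto simp: scalar_prod_def mrow_def atLeast0LessThan intro!: sum.cong)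

lemma M_self_adjoint:
  assumes "x \<in> carrier_vec n" "y \<in> carrier_vec n"
  shows "(M *\<^sub>v x) \<bullet> y = x \<bullet> (M *\<^sub>v y)"
proof -
  have "(M *\<^sub>v x) \<bullet> y = (\<Sum>v<n. mrow (vec_index x) v * vec_index y v)"
    using assms by (auto simp: scalar_prod_def atLeast0LessThan M_vec_index simp del: index_mult_mat_vec intro!: sum.cong)
  moreover have "x \<bullet> (M *\<^sub>v y) = (\<Sum>v<n. vec_index x v * mrow (vec_index y) v)"
    using assms by (auto simp: scalar_prod_def atLeast0LessThan M_vec_index simp del: index_mult_mat_vec intro!: sum.cong)
  ultimately show ?thesis by (simp add: row_symmetric)
qed

lemma M_vec_inject:
  assumes "x \<in> carrier_vec n" "y \<in> carrier_vec n" "M *\<^sub>v x = M *\<^sub>v y"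
  shows "x = y"
proof -
  have "ordH \<cdot>\<^sub>v x = ordH \<cdot>\<^sub>v y" using assms M'_M_vec by metis
  then have "ordH * vec_index x i = ordH * vec_index y i" if "i < n" for i
    using that assms by (metis carrier_vecD index_smult_vec(1))
  then show ?thesis using assms ordH_positive by (intro eq_vecI) auto
qed

section \<open>Finiteness of the level sets\<close>

definition mform_fun :: "(nat \<Rightarrow> int) \<Rightarrow> (nat \<Rightarrow> int) \<Rightarrow> int" where
  "mform_fun x y = (\<Sum>v<n. x v * mrow y v)"

lemma mform_fun_sym: "mform_fun x y = mform_fun y x"
  using row_symmetric[of x y] by (simp add: mform_fun_def mult.commute)

lemma mform_fun_lin: "mform_fun (\<lambda>v. a * x v - c * z v) y = a * mform_fun x y - c * mform_fun z y"
  by (simp add: mform_fun_def left_diff_distrib sum_subtractf sum_distrib_left mult.assoc)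

lemma mform_fun_nonpos: "mform_fun x x \<le> 0"
proof (cases "\<exists>v<n. x v \<noteq> 0")
  case True
  then show ?thesis unfolding mform_fun_def using neg_def by (meson less_imp_le)
qed (simp add: mform_fun_def)

text \<open>
  Integral version for a negative definite form: evaluate the form at the multiple
  \<open>\<langle>z,z\<rangle> x - \<langle>x,z\<rangle> z\<close> of the component of \<open>x\<close> that is orthogonal to \<open>z\<close>.
\<close>
lemma mform_fun_Cauchy_Schwarz:
  assumes "mform_fun z z < 0"
  shows "(mform_fun x z)\<^sup>2 \<le> mform_fun x x * mform_fun z z"
proof -
  let ?w = "\<lambda>v. mform_fun z z * x v - mform_fun x z * z v"
  have "mform_fun x ?w = mform_fun z z * mform_fun x x - mform_fun x z * mform_fun x z" "mform_fun z ?w = 0"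
    unfolding mform_fun_sym[of _ ?w] mform_fun_lin by (simp_all add: mform_fun_sym[of z x])
  then have "mform_fun ?w ?w = mform_fun z z * (mform_fun z z * mform_fun x x - (mform_fun x z)\<^sup>2)"
    unfolding mform_fun_lin[of _ _ _ _ ?w] by (simp add: power2_eq_square)
  then have "mform_fun z z * (mform_fun z z * mform_fun x x - (mform_fun x z)\<^sup>2) \<le> 0" using mform_fun_nonpos[of ?w] by simp
  then show ?thesis using assms by (simp add: mult_le_0_iff mult.commute)
qed

text \<open>
  Up to the factor \<open>ordH\<close>, the coordinate \<open>y\<^sub>i\<close> is the pairing of \<open>y\<close> with column \<open>i\<close> of \<open>M'\<close>. So
  the Cauchy-Schwarz inequality bounds all coordinates on a level set.
\<close>
lemma finite_mform_fun_level: "finite {y \<in> carrier_vec n. mform_fun (vec_index y) (vec_index y) = c}"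
proof -
  define z where "z i = (\<lambda>v. M' $$ (v, i))" for i
  define B where "B = (\<Sum>i<n. \<bar>c * mform_fun (z i) (z i)\<bar>)"
  have "\<bar>vec_index y i\<bar> \<le> B" if y: "y \<in> carrier_vec n" "mform_fun (vec_index y) (vec_index y) = c" and i: "i < n" for y i
  proof -
    have "mform_fun (vec_index y) (z i) = (\<Sum>v<n. if v = i then vec_index y i * ordH else 0)"
      unfolding mform_fun_def using i by (intro sum.cong) (auto simp: z_def row_M_prime)
    then have 1: "mform_fun (vec_index y) (z i) = vec_index y i * ordH" using i by simp
    have "\<exists>v<n. z i v \<noteq> 0"
    proof (rule ccontr)
      assume "\<not> (\<exists>v<n. z i v \<noteq> 0)"
      then have "mrow (z i) i = 0" by (simp add: mrow_def)
      then show False using row_M_prime[OF i i] ordH_positive by (simp add: z_def)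
    qed
    then have "mform_fun (z i) (z i) < 0" unfolding mform_fun_def using neg_def by blast
    from mform_fun_Cauchy_Schwarz[OF this, of "vec_index y"]
    have "(vec_index y i * ordH)\<^sup>2 \<le> c * mform_fun (z i) (z i)" using 1 y by simp
    also have "\<dots> \<le> \<bar>c * mform_fun (z i) (z i)\<bar>" by simp
    also have "\<dots> \<le> B" unfolding B_def using i by (intro member_le_sum) auto
    finally have "(vec_index y i * ordH)\<^sup>2 \<le> B" .
    moreover have "\<bar>a\<bar> \<le> a\<^sup>2" for a :: int
      using self_le_power[of "\<bar>a\<bar>" 2] by (cases "a = 0") auto
    moreover have "\<bar>vec_index y i\<bar> \<le> \<bar>vec_index y i * ordH\<bar>"
      using ordH_positive by (simp add: abs_mult mult_le_cancel_left1)
    ultimately show ?thesis by (meson order_trans)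
  qed
  then have "{y \<in> carrier_vec n. mform_fun (vec_index y) (vec_index y) = c}
      \<subseteq> {y \<in> carrier_vec n. \<forall>i<n. vec_index y i \<in> {-B..B}}"
    by (auto simp: abs_le_iff) (metis minus_le_iff)
  then show ?thesis by (rule finite_subset) (intro finite_vecs_with_entries, simp)
qed

section \<open>Exponents in the lattice coordinates\<close>

text \<open>
  The form \<open>|H| l\<^sup>T M\<^sup>-\<^sup>1 l\<close>, which is integral.
\<close>
definition dual_form :: "int vec \<Rightarrow> int" where "dual_form l = l \<bullet> (M' *\<^sub>v l)"

lemma M'_vec_carrier [simp]: "M' *\<^sub>v x \<in> carrier_vec n"
  by (rule carrier_vecI) simp

text \<open>
  The vector \<open>y = M' l\<close> satisfies \<open>y\<^sup>T M y = |H| l\<^sup>T M' l\<close>, and it determines \<open>l\<close>.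
\<close>
lemma finite_dual_form_level: "finite {l \<in> carrier_vec n. dual_form l = c}"
proof (rule inj_on_finite)
  show "inj_on ((*\<^sub>v) M') {l \<in> carrier_vec n. dual_form l = c}"
  proof (rule inj_onI)
    fix x y assume "x \<in> {l \<in> carrier_vec n. dual_form l = c}" "y \<in> {l \<in> carrier_vec n. dual_form l = c}" "M' *\<^sub>v x = M' *\<^sub>v y"
    then have xy: "x \<in> carrier_vec n" "y \<in> carrier_vec n" "ordH \<cdot>\<^sub>v x = ordH \<cdot>\<^sub>v y" using M_M'_vec by auto metis
    then have "ordH * vec_index x i = ordH * vec_index y i" if "i < n" for i
      using that by (metis carrier_vecD index_smult_vec(1))
    then show "x = y" using xy ordH_positive by (intro eq_vecI) auto
  qed
  show "(*\<^sub>v) M' ` {l \<in> carrier_vec n. dual_form l = c} \<subseteq> {y \<in> carrier_vec n. mform_fun (vec_index y) (vec_index y) = ordH * c}"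
  proof
    fix y assume "y \<in> (*\<^sub>v) M' ` {l \<in> carrier_vec n. dual_form l = c}"
    then obtain l where l: "l \<in> carrier_vec n" "dual_form l = c" "y = M' *\<^sub>v l" by auto
    have y: "y \<in> carrier_vec n" using l by simp
    have "mform_fun (vec_index y) (vec_index y) = y \<bullet> (M *\<^sub>v y)"
      using y by (auto simp: mform_fun_def scalar_prod_def atLeast0LessThan M_vec_index simp del: index_mult_mat_vec intro!: sum.cong)
    also have "\<dots> = y \<bullet> (ordH \<cdot>\<^sub>v l)" using l M_M'_vec by simp
    also have "\<dots> = ordH * (l \<bullet> y)" using y l comm_scalar_prod[of l n y] by simp
    finally show "y \<in> {y \<in> carrier_vec n. mform_fun (vec_index y) (vec_index y) = ordH * c}"
      using l y by (simp add: dual_form_def)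
  qed
qed (rule finite_mform_fun_level)

lemma M_inv_eq: "M_inv \<Gamma> = (1 / of_int ordH) \<cdot>\<^sub>m map_mat rat_of_int M'"
proof -
  let ?R = "map_mat rat_of_int M" and ?N = "(1 / of_int ordH) \<cdot>\<^sub>m map_mat rat_of_int M'"
  have R: "?R \<in> carrier_mat n n" "?N \<in> carrier_mat n n" by (auto intro!: carrier_matI)
  have D0: "rat_of_int ordH \<noteq> 0" using ordH_positive by simp
  have "?R * ?N = (1 / of_int ordH) \<cdot>\<^sub>m (?R * map_mat rat_of_int M')"
    by (rule mult_smult_distrib[of _ n n _ n]) (auto intro!: carrier_matI)
  also have "?R * map_mat rat_of_int M' = map_mat rat_of_int (M * M')"
    by (rule of_int_hom.mat_hom_mult[symmetric, of _ n n _ n]) auto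
  also have "(1 / of_int ordH) \<cdot>\<^sub>m map_mat rat_of_int (M * M') = 1\<^sub>m n"
    unfolding M_mult_M_prime using D0 by (intro eq_matI) auto
  finally have RN: "?R * ?N = 1\<^sub>m n" .
  have "?N * ?R = (1 / of_int ordH) \<cdot>\<^sub>m (map_mat rat_of_int M' * ?R)"
    by (rule mult_smult_assoc_mat[of _ n n _ n]) (auto intro!: carrier_matI)
  also have "map_mat rat_of_int M' * ?R = map_mat rat_of_int (M' * M)"
    by (rule of_int_hom.mat_hom_mult[symmetric, of _ n n _ n]) auto
  also have "(1 / of_int ordH) \<cdot>\<^sub>m map_mat rat_of_int (M' * M) = 1\<^sub>m n"
    unfolding M'_mult_M using D0 by (intro eq_matI) auto
  finally have NR: "?N * ?R = 1\<^sub>m n" .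
  have "?R \<in> Units (ring_mat TYPE(rat) n ())"
    unfolding Units_def using R RN NR by (auto simp: ring_mat_simps)
  then obtain B where B: "mat_inverse ?R = Some B" using mat_inverse(1)[OF R(1), of "()"] by (cases "mat_inverse ?R") auto
  note B' = mat_inverse(2)[OF R(1) B]
  have "B = B * (?R * ?N)" unfolding RN using B' by (intro right_mult_one_mat[symmetric]) blast
  also have "\<dots> = (B * ?R) * ?N" using B' R by (intro assoc_mult_mat[symmetric]) auto
  also have "\<dots> = ?N" using B' R(2) left_mult_one_mat[OF R(2)] by simp
  finally show ?thesis using B by (simp add: M_inv_def)
qed

lemma M_inv_form:
  assumes "l \<in> carrier_vec n"
  shows "map_vec rat_of_int l \<bullet> (M_inv \<Gamma> *\<^sub>v map_vec rat_of_int l) = of_int (dual_form l) / of_int ordH"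
proof -
  have "M_inv \<Gamma> *\<^sub>v map_vec rat_of_int l = (1 / of_int ordH) \<cdot>\<^sub>v (map_mat rat_of_int M' *\<^sub>v map_vec rat_of_int l)"
    unfolding M_inv_eq using assms by (intro eq_vecI) (auto simp: smult_scalar_prod_distrib)
  also have "map_mat rat_of_int M' *\<^sub>v map_vec rat_of_int l = map_vec rat_of_int (M' *\<^sub>v l)"
    by (rule of_int_hom.mult_mat_vec_hom[OF M'_carrier assms, symmetric])
  finally have "map_vec rat_of_int l \<bullet> (M_inv \<Gamma> *\<^sub>v map_vec rat_of_int l)
      = (1 / of_int ordH) * (map_vec rat_of_int l \<bullet> map_vec rat_of_int (M' *\<^sub>v l))"
    using assms by simp
  also have "map_vec rat_of_int l \<bullet> map_vec rat_of_int (M' *\<^sub>v l) = of_int (dual_form l)"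
    using assms by (auto simp: dual_form_def scalar_prod_def)
  finally show ?thesis by simp
qed

definition q_exponent :: "int vec \<Rightarrow> rat" where
  "q_exponent l = - (of_int (dual_form l) / of_int ordH + of_int (3 * int n + trace_wt \<Gamma>)) / 4"

definition translate :: "int vec \<Rightarrow> int vec \<Rightarrow> int vec" where
  "translate \<kappa> x = 2 \<cdot>\<^sub>v (M *\<^sub>v x) + \<kappa> - M *\<^sub>v u"

lemma translate_carrier [simp]: "\<kappa> \<in> carrier_vec n \<Longrightarrow> translate \<kappa> x \<in> carrier_vec n"
  by (auto simp: translate_def)

lemma dual_form_translate:
  assumes w: "w \<in> carrier_vec n" and x: "x \<in> carrier_vec n"
  shows "dual_form (2 \<cdot>\<^sub>v (M *\<^sub>v x) + w) = dual_form w + 4 * ordH * (x \<bullet> w + x \<bullet> (M *\<^sub>v x))"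
proof -
  let ?y = "2 \<cdot>\<^sub>v (M *\<^sub>v x)"
  have "M' *\<^sub>v (?y + w) = M' *\<^sub>v ?y + M' *\<^sub>v w"
    using w by (intro mult_add_distrib_mat_vec[OF M'_carrier]) auto
  also have "M' *\<^sub>v ?y = (2 * ordH) \<cdot>\<^sub>v x"
  proof -
    have "M' *\<^sub>v ?y = M' *\<^sub>v (M *\<^sub>v (2 \<cdot>\<^sub>v x))"
      using x by (intro arg_cong[of _ _ "(*\<^sub>v) M'"] eq_vecI) auto
    also have "\<dots> = ordH \<cdot>\<^sub>v (2 \<cdot>\<^sub>v x)" using x by (intro M'_M_vec) simp
    finally show ?thesis by (simp add: smult_smult_assoc mult.commute)
  qed
  finally have "dual_form (?y + w) = (?y + w) \<bullet> ((2 * ordH) \<cdot>\<^sub>v x + M' *\<^sub>v w)" by (simp add: dual_form_def)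
  also have "\<dots> = ?y \<bullet> ((2 * ordH) \<cdot>\<^sub>v x + M' *\<^sub>v w) + w \<bullet> ((2 * ordH) \<cdot>\<^sub>v x + M' *\<^sub>v w)"
    using w x by (intro add_scalar_prod_distrib[of _ n]) auto
  also have "w \<bullet> ((2 * ordH) \<cdot>\<^sub>v x + M' *\<^sub>v w) = w \<bullet> ((2 * ordH) \<cdot>\<^sub>v x) + dual_form w"
    unfolding dual_form_def using w x by (intro scalar_prod_add_distrib[of _ n]) auto
  also have "?y \<bullet> ((2 * ordH) \<cdot>\<^sub>v x + M' *\<^sub>v w) = ?y \<bullet> ((2 * ordH) \<cdot>\<^sub>v x) + ?y \<bullet> (M' *\<^sub>v w)"
    using w x by (intro scalar_prod_add_distrib[of _ n]) auto
  also have "?y \<bullet> (M' *\<^sub>v w) = 2 * (x \<bullet> (M *\<^sub>v (M' *\<^sub>v w)))"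
    using w x M_self_adjoint[OF x M'_vec_carrier] by (simp add: smult_scalar_prod_distrib[of _ n])
  also have "\<dots> = 2 * ordH * (x \<bullet> w)" using w x M_M'_vec[OF w] by simp
  also have "?y \<bullet> ((2 * ordH) \<cdot>\<^sub>v x) = 4 * ordH * (x \<bullet> (M *\<^sub>v x))"
    using w x M_self_adjoint[OF x x] by (simp add: smult_scalar_prod_distrib[of _ n])
  also have "w \<bullet> ((2 * ordH) \<cdot>\<^sub>v x) = 2 * ordH * (x \<bullet> w)"
    using w x comm_scalar_prod[OF w x] by simp
  finally show ?thesis by (simp add: algebra_simps)
qed

lemma translate_assoc: "\<kappa> \<in> carrier_vec n \<Longrightarrow> translate \<kappa> x = 2 \<cdot>\<^sub>v (M *\<^sub>v x) + (\<kappa> - M *\<^sub>v u)"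
  unfolding translate_def by (intro eq_vecI) auto

text \<open>
  Completing the square: apart from the constant, the exponent of \<open>q\<close> is a quadratic form in the
  translated vector alone, so it does not refer to the choice of a representative.
\<close>
lemma eps_translate:
  assumes k: "\<kappa> \<in> carrier_vec n" and x: "x \<in> carrier_vec n"
  shows "eps \<Gamma> \<kappa> x = q_exponent (translate \<kappa> x)"
proof -
  let ?w = "\<kappa> - M *\<^sub>v u"
  have w: "?w \<in> carrier_vec n" using k by simp
  have xw: "x \<bullet> ?w = \<kappa> \<bullet> x - x \<bullet> (M *\<^sub>v u)"
    using scalar_prod_minus_distrib[OF x k M_vec_carrier, of u] comm_scalar_prod[OF x k] by simp
  have "eps \<Gamma> \<kappa> x = - (of_int (dual_form ?w) / of_int ordH + of_int (3 * int n + trace_wt \<Gamma>)) / 4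
      - of_int (\<kappa> \<bullet> x + x \<bullet> (M *\<^sub>v x)) + of_int (x \<bullet> (M *\<^sub>v u))"
    unfolding eps_def Let_def M_inv_form[OF w] by (simp add: chi_def mform_def)
  also have "\<dots> = q_exponent (translate \<kappa> x)"
    unfolding q_exponent_def translate_assoc[OF k] dual_form_translate[OF w x] xw using ordH_positive
    by (simp add: field_simps)
  finally show ?thesis .
qed

lemma Theta_translate:
  assumes k: "\<kappa> \<in> carrier_vec n" and x: "x \<in> carrier_vec n"
  shows "Theta \<Gamma> \<kappa> + of_int (mform \<Gamma> x u) = of_int (translate \<kappa> x \<bullet> u) / 2"
proof -
  let ?w = "\<kappa> - M *\<^sub>v u"
  have w: "?w \<in> carrier_vec n" using k by simp
  have "translate \<kappa> x \<bullet> u = (2 \<cdot>\<^sub>v (M *\<^sub>v x)) \<bullet> u + ?w \<bullet> u"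
    unfolding translate_assoc[OF k] using w by (intro add_scalar_prod_distrib[of _ n]) auto
  also have "?w \<bullet> u = \<kappa> \<bullet> u - (M *\<^sub>v u) \<bullet> u"
    using k by (intro minus_scalar_prod_distrib[of _ n]) auto
  also have "(2 \<cdot>\<^sub>v (M *\<^sub>v x)) \<bullet> u = 2 * (x \<bullet> (M *\<^sub>v u))"
    using M_self_adjoint[OF x u_carrier] by (simp add: smult_scalar_prod_distrib[of _ n])
  finally show ?thesis using M_self_adjoint[OF u_carrier u_carrier]
    by (simp add: Theta_def mform_def field_simps)
qed

section \<open>Summation over all spin\<open>\<^sup>c\<close> structures\<close>

text \<open>
  The lattice coset \<open>\<delta> + 2\<int>\<^sup>s\<close> of the vectors \<open>2Mx + \<kappa> - Mu\<close>.
\<close>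
definition charges :: "int vec set" where
  "charges = {l \<in> carrier_vec n. \<forall>i<n. even (vec_index l i - int (deg \<Gamma> i))}"

definition spinc_rel :: "(int vec \<times> int vec) set" where
  "spinc_rel = {(k, k'). k \<in> characteristic_vectors \<Gamma> \<and> k' \<in> characteristic_vectors \<Gamma> \<and>
        (\<exists>x \<in> carrier_vec n. k' = k + 2 \<cdot>\<^sub>v (M *\<^sub>v x))}"

lemma spinc_eq: "spinc \<Gamma> = characteristic_vectors \<Gamma> // spinc_rel"
  by (simp add: spinc_def spinc_rel_def)

lemma char_carrier: "\<kappa> \<in> characteristic_vectors \<Gamma> \<Longrightarrow> \<kappa> \<in> carrier_vec n"
  by (simp add: characteristic_vectors_def)

lemma equiv_spinc: "equiv (characteristic_vectors \<Gamma>) spinc_rel"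
proof (rule equivI)
  show "spinc_rel \<subseteq> characteristic_vectors \<Gamma> \<times> characteristic_vectors \<Gamma>"
    by (auto simp: spinc_rel_def)
  show "refl_on (characteristic_vectors \<Gamma>) spinc_rel"
  proof (rule refl_onI)
    fix \<kappa> assume k: "\<kappa> \<in> characteristic_vectors \<Gamma>"
    have "\<kappa> = \<kappa> + 2 \<cdot>\<^sub>v (M *\<^sub>v 0\<^sub>v n)" using char_carrier[OF k] by (intro eq_vecI) auto
    then show "(\<kappa>, \<kappa>) \<in> spinc_rel" using k by (auto simp: spinc_rel_def intro!: bexI[of _ "0\<^sub>v n"])
  qed
  show "sym spinc_rel"
  proof (rule symI)
    fix \<kappa> \<kappa>' assume "(\<kappa>, \<kappa>') \<in> spinc_rel"
    then obtain x where k: "\<kappa> \<in> characteristic_vectors \<Gamma>" "\<kappa>' \<in> characteristic_vectors \<Gamma>"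
      "x \<in> carrier_vec n" "\<kappa>' = \<kappa> + 2 \<cdot>\<^sub>v (M *\<^sub>v x)" by (auto simp: spinc_rel_def)
    have "\<kappa> = \<kappa>' + 2 \<cdot>\<^sub>v (M *\<^sub>v (- x))"
      using k(3,4) char_carrier[OF k(1)] by (intro eq_vecI) auto
    then show "(\<kappa>', \<kappa>) \<in> spinc_rel" using k by (auto simp: spinc_rel_def intro!: bexI[of _ "- x"])
  qed
  show "trans spinc_rel"
  proof (rule transI)
    fix \<kappa> \<kappa>' \<kappa>'' assume "(\<kappa>, \<kappa>') \<in> spinc_rel" "(\<kappa>', \<kappa>'') \<in> spinc_rel"
    then obtain x y where k: "\<kappa> \<in> characteristic_vectors \<Gamma>" "\<kappa>'' \<in> characteristic_vectors \<Gamma>"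
      "x \<in> carrier_vec n" "y \<in> carrier_vec n" "\<kappa>'' = (\<kappa> + 2 \<cdot>\<^sub>v (M *\<^sub>v x)) + 2 \<cdot>\<^sub>v (M *\<^sub>v y)"
      by (auto simp: spinc_rel_def)
    have "M *\<^sub>v (x + y) = M *\<^sub>v x + M *\<^sub>v y" by (rule mult_add_distrib_mat_vec[OF M_carrier k(3,4)])
    then have "\<kappa>'' = \<kappa> + 2 \<cdot>\<^sub>v (M *\<^sub>v (x + y))"
      using k(5) char_carrier[OF k(1)] by (intro eq_vecI) auto
    then show "(\<kappa>, \<kappa>'') \<in> spinc_rel" using k by (auto simp: spinc_rel_def intro!: bexI[of _ "x + y"])
  qed
qed

definition rep :: "int vec set \<Rightarrow> int vec" where "rep K = (SOME \<kappa>. \<kappa> \<in> K)"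

lemma rep_in: "K \<in> spinc \<Gamma> \<Longrightarrow> rep K \<in> K"
  unfolding rep_def spinc_eq using in_quotient_imp_non_empty[OF equiv_spinc] by (simp add: some_in_eq)

lemma rep_char: "K \<in> spinc \<Gamma> \<Longrightarrow> rep K \<in> characteristic_vectors \<Gamma>"
  using rep_in in_quotient_imp_subset[OF equiv_spinc] unfolding spinc_eq by blast

lemma spinc_eqI:
  assumes "K \<in> spinc \<Gamma>" "K' \<in> spinc \<Gamma>" "x \<in> carrier_vec n" "rep K' = rep K + 2 \<cdot>\<^sub>v (M *\<^sub>v x)"
  shows "K = K'"
proof -
  have "(rep K, rep K') \<in> spinc_rel"
    unfolding spinc_rel_def using assms(3,4) rep_char[OF assms(1)] rep_char[OF assms(2)] by blast
  then show ?thesis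
    using quotient_eq_iff[OF equiv_spinc] assms(1,2) rep_in unfolding spinc_eq by blast
qed

text \<open>
  Vectors that agree modulo \<open>2|H|\<close> are in the same class, because \<open>|H| y = M (M' y)\<close>.
\<close>
lemma finite_spinc: "finite (spinc \<Gamma>)"
proof (rule inj_on_finite)
  let ?f = "\<lambda>K. vec n (\<lambda>i. vec_index (rep K) i mod (2 * ordH))"
  show "inj_on ?f (spinc \<Gamma>)"
  proof (rule inj_onI)
    fix K K' assume K: "K \<in> spinc \<Gamma>" "K' \<in> spinc \<Gamma>" and eq: "?f K = ?f K'"
    note c = char_carrier[OF rep_char[OF K(1)]] char_carrier[OF rep_char[OF K(2)]]
    define y where "y = vec n (\<lambda>i. (vec_index (rep K') i - vec_index (rep K) i) div (2 * ordH))"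
    have y: "y \<in> carrier_vec n" by (simp add: y_def)
    have "rep K' = rep K + 2 \<cdot>\<^sub>v (ordH \<cdot>\<^sub>v y)"
    proof (rule eq_vecI)
      fix i assume "i < dim_vec (rep K + 2 \<cdot>\<^sub>v (ordH \<cdot>\<^sub>v y))"
      then have i: "i < n" using y by simp
      have "vec_index (?f K) i = vec_index (?f K') i" using eq by simp
      then have "2 * ordH dvd vec_index (rep K') i - vec_index (rep K) i"
        using i by (simp add: mod_eq_dvd_iff dvd_diff_commute)
      then have "2 * ordH * ((vec_index (rep K') i - vec_index (rep K) i) div (2 * ordH))
          = vec_index (rep K') i - vec_index (rep K) i" by simp
      then show "vec_index (rep K') i = vec_index (rep K + 2 \<cdot>\<^sub>v (ordH \<cdot>\<^sub>v y)) i"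
        using i c y by (simp add: y_def)
    qed (use c y in auto)
    then have "rep K' = rep K + 2 \<cdot>\<^sub>v (M *\<^sub>v (M' *\<^sub>v y))" using M_M'_vec[OF y] by simp
    then show "K = K'" using spinc_eqI[OF K M'_vec_carrier] by blast
  qed
  show "?f ` spinc \<Gamma> \<subseteq> {v \<in> carrier_vec n. \<forall>i<n. vec_index v i \<in> {0..<2 * ordH}}"
    using ordH_positive by auto
qed (intro finite_vecs_with_entries, simp)

lemma M_u_index: "i < n \<Longrightarrow> vec_index (M *\<^sub>v u) i = wt \<Gamma> i + int (deg \<Gamma> i)"
  by (subst M_vec_index) (auto simp: row_neighbours deg_def uvec_def)

lemma bij_translate:
  "bij_betw (\<lambda>(K, x). translate (rep K) x) (spinc \<Gamma> \<times> carrier_vec n) charges"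
proof (rule bij_betwI')
  fix z z' :: "int vec set \<times> int vec"
  assume "z \<in> spinc \<Gamma> \<times> carrier_vec n" "z' \<in> spinc \<Gamma> \<times> carrier_vec n"
  then obtain K x K' x' where zz: "z = (K, x)" "z' = (K', x')" and K: "K \<in> spinc \<Gamma>" "K' \<in> spinc \<Gamma>"
    and x: "x \<in> carrier_vec n" "x' \<in> carrier_vec n" by auto
  note c = char_carrier[OF rep_char[OF K(1)]] char_carrier[OF rep_char[OF K(2)]]
  have "K = K' \<and> x = x'" if eq: "translate (rep K) x = translate (rep K') x'"
  proof -
    have Mm: "M *\<^sub>v (x - x') = M *\<^sub>v x - M *\<^sub>v x'" by (rule mult_minus_distrib_mat_vec[OF M_carrier x])
    have ent: "vec_index (translate (rep K) x) i = vec_index (translate (rep K') x') i" for i using eq by simp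
    have "rep K' = rep K + 2 \<cdot>\<^sub>v (M *\<^sub>v (x - x'))"
    proof (rule eq_vecI)
      fix i assume "i < dim_vec (rep K + 2 \<cdot>\<^sub>v (M *\<^sub>v (x - x')))"
      then have i: "i < n" by simp
      then show "vec_index (rep K') i = vec_index (rep K + 2 \<cdot>\<^sub>v (M *\<^sub>v (x - x'))) i"
        unfolding Mm using c ent[of i] by (simp add: translate_def del: index_mult_mat_vec)
    qed (use c in auto)
    moreover have "x - x' \<in> carrier_vec n" using x by simp
    ultimately have KK: "K = K'" by (intro spinc_eqI[OF K, of "x - x'"])
    have "M *\<^sub>v x = M *\<^sub>v x'"
    proof (rule eq_vecI)
      fix i assume "i < dim_vec (M *\<^sub>v x')"
      then have i: "i < n" by simp
      then show "vec_index (M *\<^sub>v x) i = vec_index (M *\<^sub>v x') i"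
        using c ent[of i] KK by (simp add: translate_def del: index_mult_mat_vec)
    qed auto
    then show ?thesis using KK M_vec_inject[OF x] by simp
  qed
  then show "((case z of (K, x) \<Rightarrow> translate (rep K) x) = (case z' of (K, x) \<Rightarrow> translate (rep K) x)) = (z = z')"
    using zz by auto
next
  fix z :: "int vec set \<times> int vec"
  assume "z \<in> spinc \<Gamma> \<times> carrier_vec n"
  then obtain K x where z: "z = (K, x)" and K: "K \<in> spinc \<Gamma>" and x: "x \<in> carrier_vec n" by auto
  note r = rep_char[OF K] note c = char_carrier[OF r]
  have "even (vec_index (translate (rep K) x) i - int (deg \<Gamma> i))" if i: "i < n" for i
  proof -
    have eq: "vec_index (translate (rep K) x) i - int (deg \<Gamma> i)
        = 2 * (vec_index (M *\<^sub>v x) i - int (deg \<Gamma> i)) + (vec_index (rep K) i - wt \<Gamma> i)"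
      using i c M_u_index[OF i] by (simp add: translate_def del: index_mult_mat_vec)
    have "even (vec_index (rep K) i - wt \<Gamma> i)"
      using r i unfolding characteristic_vectors_def by blast
    then show ?thesis unfolding eq by (intro dvd_add dvd_triv_left)
  qed
  then show "(case z of (K, x) \<Rightarrow> translate (rep K) x) \<in> charges" using z c by (simp add: charges_def)
next
  fix l assume l: "l \<in> charges"
  then have lc: "l \<in> carrier_vec n" by (simp add: charges_def)
  define \<kappa> where "\<kappa> = l + M *\<^sub>v u"
  have kc: "\<kappa> \<in> carrier_vec n" using lc by (simp add: \<kappa>_def)
  have k: "\<kappa> \<in> characteristic_vectors \<Gamma>"
  proof -
    have "even (vec_index \<kappa> i - wt \<Gamma> i)" if i: "i < n" for i
    proof -
      have "vec_index \<kappa> i - wt \<Gamma> i = (vec_index l i - int (deg \<Gamma> i)) + 2 * int (deg \<Gamma> i)"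
        using i lc M_u_index[OF i] by (simp add: \<kappa>_def del: index_mult_mat_vec)
      then show ?thesis using l i by (simp add: charges_def)
    qed
    then show ?thesis using kc by (simp add: characteristic_vectors_def)
  qed
  define K where "K = spinc_rel `` {\<kappa>}"
  have K: "K \<in> spinc \<Gamma>" unfolding K_def spinc_eq using k by (rule quotientI)
  have "\<kappa> \<in> K" unfolding K_def using equiv_class_self[OF equiv_spinc k] .
  then have "(rep K, \<kappa>) \<in> spinc_rel"
    using quotient_eq_iff[OF equiv_spinc, of K K "rep K" \<kappa>] K rep_in[OF K] unfolding spinc_eq by simp
  then obtain x where x: "x \<in> carrier_vec n" "\<kappa> = rep K + 2 \<cdot>\<^sub>v (M *\<^sub>v x)" by (auto simp: spinc_rel_def)
  note c = char_carrier[OF rep_char[OF K]]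
  have "l = translate (rep K) x"
  proof (rule eq_vecI)
    fix i assume "i < dim_vec (translate (rep K) x)"
    then have i: "i < n" using c by (simp add: translate_def)
    have "vec_index (l + M *\<^sub>v u) i = vec_index (rep K + 2 \<cdot>\<^sub>v (M *\<^sub>v x)) i"
      using x(2) by (simp add: \<kappa>_def)
    then show "vec_index l i = vec_index (translate (rep K) x) i"
      using i c lc by (simp add: translate_def del: index_mult_mat_vec)
  qed (use c lc in \<open>auto simp: translate_def\<close>)
  then show "\<exists>z\<in>spinc \<Gamma> \<times> carrier_vec n. l = (case z of (K, x) \<Rightarrow> translate (rep K) x)"
    using K x(1) by auto
qed

definition weight :: "int vec \<Rightarrow> rat" where
  "weight l = (\<Prod>i<n. W_hat (deg \<Gamma> i) (vec_index l i))"

lemma finite_q_exponent_level: "finite {l \<in> carrier_vec n. q_exponent l = e}"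
proof (cases "\<exists>l0 \<in> carrier_vec n. q_exponent l0 = e")
  case True
  then obtain l0 where "q_exponent l0 = e" by blast
  moreover have "x = y" if "- (x + c) / 4 = e" "- (y + c) / 4 = e" for x y c :: rat
  proof -
    from that have "- (x + c) / 4 = - (y + c) / 4" by simp
    then show ?thesis by simp
  qed
  ultimately have "of_int (dual_form l) / of_int ordH = (of_int (dual_form l0) / of_int ordH :: rat)" if "q_exponent l = e" for l
    using that unfolding q_exponent_def by blast
  then have "{l \<in> carrier_vec n. q_exponent l = e} \<subseteq> {l \<in> carrier_vec n. dual_form l = dual_form l0}"
    using ordH_positive by auto
  then show ?thesis using finite_dual_form_level finite_subset by blast
next
  case False
  then have "{l \<in> carrier_vec n. q_exponent l = e} = {}" by blast
  then show ?thesis by (simp only: finite.emptyI)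
qed

text \<open>
  Weight and exponents depend on the pair of a spin\<open>\<^sup>c\<close> structure and a lattice point only through
  the translated vector, and \<open>bij_translate\<close> reindexes the sum by it.
\<close>
lemma Z_hat_hat_0_charges:
  "Z_hat_hat_0 \<Gamma> e r = (\<Sum>l | l \<in> charges \<and> q_exponent l = e \<and> of_int (l \<bullet> u) / 2 = r. weight l)"
proof -
  let ?P = "\<lambda>l. q_exponent l = e \<and> of_int (l \<bullet> u) / 2 = r"
  let ?S = "\<lambda>K. {x \<in> carrier_vec n. ?P (translate (rep K) x)}"
  have Z: "Z_hat_hat \<Gamma> (rep K) e r = (\<Sum>x\<in>?S K. weight (translate (rep K) x))" if K: "K \<in> spinc \<Gamma>" for K
  proof -
    note c = char_carrier[OF rep_char[OF K]]
    show ?thesis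
      unfolding Z_hat_hat_def weight_def
    proof (rule sum.cong)
      show "{x. x \<in> carrier_vec n \<and> eps \<Gamma> (rep K) x = e \<and> Theta \<Gamma> (rep K) + of_int (mform \<Gamma> x u) = r} = ?S K"
        by (intro Collect_cong conj_cong refl) (simp_all only: eps_translate[OF c] Theta_translate[OF c])
    qed (simp only: translate_def)
  qed
  have fin: "finite (?S K)" if K: "K \<in> spinc \<Gamma>" for K
  proof (rule inj_on_finite)
    note c = char_carrier[OF rep_char[OF K]]
    show "inj_on (translate (rep K)) (?S K)"
    proof (rule inj_onI)
      fix x y assume "x \<in> ?S K" "y \<in> ?S K" "translate (rep K) x = translate (rep K) y"
      then show "x = y"
        using inj_onD[OF bij_betw_imp_inj_on[OF bij_translate], of "(K, x)" "(K, y)"] K by simp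
    qed
    show "translate (rep K) ` ?S K \<subseteq> {l \<in> carrier_vec n. q_exponent l = e}" using translate_carrier[OF c] by blast
  qed (rule finite_q_exponent_level)
  have "Z_hat_hat_0 \<Gamma> e r = (\<Sum>K\<in>spinc \<Gamma>. \<Sum>x\<in>?S K. weight (translate (rep K) x))"
    unfolding Z_hat_hat_0_def rep_def[symmetric] using Z by (intro sum.cong) auto
  also have "\<dots> = (\<Sum>(K, x)\<in>Sigma (spinc \<Gamma>) ?S. weight (translate (rep K) x))"
    using fin finite_spinc by (intro sum.Sigma) auto
  also have "\<dots> = (\<Sum>l | l \<in> charges \<and> ?P l. weight l)"
  proof -
    have "bij_betw (\<lambda>(K, x). translate (rep K) x) (Sigma (spinc \<Gamma>) ?S) {l \<in> charges. ?P l}"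
    proof (rule bij_betw_subset[OF bij_translate])
      have "(\<lambda>(K, x). translate (rep K) x) ` Sigma (spinc \<Gamma>) ?S
          = {l \<in> (\<lambda>(K, x). translate (rep K) x) ` (spinc \<Gamma> \<times> carrier_vec n). ?P l}"
        by (force simp: image_def)
      then show "(\<lambda>(K, x). translate (rep K) x) ` Sigma (spinc \<Gamma>) ?S = {l \<in> charges. ?P l}"
        using bij_translate by (simp add: bij_betw_def)
    qed auto
    from sum.reindex_bij_betw[OF this, of weight] show ?thesis by (simp add: case_prod_unfold)
  qed
  finally show ?thesis .
qed

end

section \<open>Comparison of the two series\<close>

lemma finite_square_level: "finite {N::int. (of_int N)\<^sup>2 / c = (e::rat)}" if "c \<noteq> 0"
proof (cases "\<exists>N0::int. (of_int N0)\<^sup>2 / c = e")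
  case True
  then obtain N0 :: int where N0: "(of_int N0)\<^sup>2 / c = e" by blast
  have "N = N0 \<or> N = - N0" if "(of_int N)\<^sup>2 / c = e" for N :: int
  proof -
    have "(of_int N :: rat)\<^sup>2 = (of_int N0)\<^sup>2" using N0 that \<open>c \<noteq> 0\<close> by (simp add: field_simps)
    then have "N\<^sup>2 = N0\<^sup>2" by (simp flip: of_int_power)
    then show ?thesis by (simp add: power2_eq_iff)
  qed
  then have "{N::int. (of_int N)\<^sup>2 / c = e} \<subseteq> {N0, - N0}" by auto
  then show ?thesis by (rule finite_subset) simp
qed simp

context negative_star_plumbing
begin

text \<open>
  Every vector of nonzero weight is of this form. The sign at a leaf is \<open>+1\<close> on \<open>X\<close>, although
  \<open>W_hat 1 1 = - 1\<close>: then \<open>X\<close> is the same set as in the expansion of the numerator of \<open>f\<^sub>0\<close>.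
\<close>
definition charge :: "int \<Rightarrow> nat set \<Rightarrow> int vec" where
  "charge m X = vec n (\<lambda>i. if i = 0 then m else if i \<le> k then (if i \<in> X then 1 else - 1) else 0)"

lemma charge_carrier [simp]: "charge m X \<in> carrier_vec n" by (simp add: charge_def)

lemma dim_charge [simp]: "dim_vec (charge m X) = n" by (simp add: charge_def)

lemma charge_index:
  "vec_index (charge m X) 0 = m"
  "i \<in> {1..k} \<Longrightarrow> vec_index (charge m X) i = (if i \<in> X then 1 else - 1)"
  "k < i \<Longrightarrow> i < n \<Longrightarrow> vec_index (charge m X) i = 0"
  using k_less by (auto simp: charge_def)

lemma vertices_split: "{..<n} = insert 0 ({1..k} \<union> {Suc k..<n})"
  using k_less by auto

lemma sum_charge:
  assumes "\<And>i. k < i \<Longrightarrow> i < n \<Longrightarrow> f i = (0 :: 'a::comm_monoid_add)"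
  shows "(\<Sum>i<n. f i) = (\<Sum>i\<le>k. f i)"
  using k_less assms by (intro sum.mono_neutral_right) auto

lemma atMost_split: "{..k} = insert 0 {1..k}" by auto

lemma charge_dot_u: "charge m X \<bullet> u = m + signed_sum {1..k} (\<lambda>_. 1) X"
proof -
  have "charge m X \<bullet> u = (\<Sum>i<n. vec_index (charge m X) i)"
    by (simp add: scalar_prod_def uvec_def atLeast0LessThan)
  also have "\<dots> = (\<Sum>i\<le>k. vec_index (charge m X) i)"
    by (rule sum_charge) (simp add: charge_index)
  also have "\<dots> = m + (\<Sum>i\<in>{1..k}. vec_index (charge m X) i)"
    unfolding atMost_split by (simp add: charge_index(1))
  also have "(\<Sum>i\<in>{1..k}. vec_index (charge m X) i) = signed_sum {1..k} (\<lambda>_. 1) X"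
    unfolding signed_sum_def by (rule sum.cong) (simp_all add: charge_index)
  finally show ?thesis .
qed

text \<open>
  On the node and the leaves, \<open>M'\<close> is \<open>- A c c\<^sup>T\<close> with \<open>c = (1, 1/a\<^sub>1, \<dots>, 1/a\<^sub>k)\<close>, corrected on the
  diagonal entries of the leaves only.
\<close>
lemma M_prime_entry:
  fixes c :: "nat \<Rightarrow> rat"
  defines "c \<equiv> \<lambda>i. if i = 0 then 1 else 1 / of_int (tail_cont i 0)"
  assumes ij: "i \<le> k" "j \<le> k"
  shows "of_int (M' $$ (i, j)) = - of_int leg_prod * c i * c j
    + (if i = j \<and> i \<noteq> 0 then of_int (M' $$ (i, i)) + of_int leg_prod * (c i)\<^sup>2 else 0)"
proof -
  have tr: "of_int (trunk j) = of_int leg_prod * c j" if "j \<le> k" for j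
  proof (cases "j = 0")
    case False
    then have j: "j \<in> {1..k}" using that by simp
    then show ?thesis using leg_prod_except[OF j] tail_cont_positive[OF j, of 0] False
      by (simp add: trunk_leaf c_def)
  qed (simp add: trunk_def c_def)
  have jn: "j < n" using ij k_less by simp
  consider "i = 0" | "i \<noteq> 0" "i = j" | "i \<noteq> 0" "i \<noteq> j" by blast
  then show ?thesis
  proof cases
    case 1
    then show ?thesis using M_prime_node_row[OF jn] tr[OF ij(2)] by (simp add: c_def)
  next
    case 2
    then show ?thesis by (simp add: power2_eq_square)
  next
    case 3
    then have i: "i \<in> {1..k}" using ij by simp
    have "leg j \<noteq> i \<or> j = 0"
      using leaf_nth[of j] legs_nonempty[of j] leg_pos_nth(1)[of j "length (legs j) - 1"] ij 3 by (cases "j = 0") auto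
    from M_prime_leaf_row[OF i jn this]
    have "of_int (tail_cont i 0) * of_int (M' $$ (i, j)) = - (of_int leg_prod * c j)"
      unfolding tr[OF ij(2), symmetric] by (metis of_int_minus of_int_mult)
    then show ?thesis using tail_cont_positive[OF i, of 0] 3 by (simp add: c_def field_simps)
  qed
qed

text \<open>
  The rank-one part of \<open>M'\<close> gives a square. The diagonal correction does not depend on the signs at
  the leaves, since these have square 1.
\<close>
lemma dual_form_charge:
  "of_int (dual_form (charge m X)) =
    - (of_int (leg_prod * m + signed_sum {1..k} leg_prod_except X))\<^sup>2 / of_int leg_prod
    + (\<Sum>i=1..k. of_int (M' $$ (i, i)) + of_int leg_prod / (of_int (tail_cont i 0))\<^sup>2 :: rat)"
proof -
  define c :: "nat \<Rightarrow> rat" where "c i = (if i = 0 then 1 else 1 / of_int (tail_cont i 0))" for i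
  define l where "l i = rat_of_int (vec_index (charge m X) i)" for i
  define d where "d i = (if i = 0 then 0 else of_int (M' $$ (i, i)) + of_int leg_prod * (c i)\<^sup>2)" for i
  have Mc: "of_int (M' $$ (i, j)) = - of_int leg_prod * c i * c j + (if i = j then d i else 0)"
    if "i \<le> k" "j \<le> k" for i j
    using M_prime_entry[OF that] unfolding c_def d_def by auto
  have "of_int (dual_form (charge m X)) = (\<Sum>i<n. \<Sum>j<n. l i * of_int (M' $$ (i, j)) * l j)"
    by (auto simp: dual_form_def scalar_prod_def atLeast0LessThan l_def sum_distrib_left mult.assoc intro!: sum.cong)
  also have "\<dots> = (\<Sum>i\<le>k. \<Sum>j<n. l i * of_int (M' $$ (i, j)) * l j)"
    by (rule sum_charge) (simp add: l_def charge_index)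
  also have "\<dots> = (\<Sum>i\<le>k. \<Sum>j\<le>k. l i * of_int (M' $$ (i, j)) * l j)"
    by (intro sum.cong refl sum_charge) (simp add: l_def charge_index)
  also have "\<dots> = (\<Sum>i\<le>k. \<Sum>j\<le>k. - of_int leg_prod * ((l i * c i) * (l j * c j)) + (if i = j then (l i)\<^sup>2 * d i else 0))"
    by (intro sum.cong refl) (auto simp: Mc algebra_simps power2_eq_square)
  also have "\<dots> = (\<Sum>i\<le>k. - of_int leg_prod * ((l i * c i) * (\<Sum>j\<le>k. l j * c j)) + (l i)\<^sup>2 * d i)"
    by (intro sum.cong refl, simp only: sum.distrib sum_distrib_left[symmetric]) simp
  also have "\<dots> = - of_int leg_prod * ((\<Sum>i\<le>k. l i * c i) * (\<Sum>j\<le>k. l j * c j)) + (\<Sum>i\<le>k. (l i)\<^sup>2 * d i)"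
    by (simp only: sum.distrib sum_distrib_left[symmetric] sum_distrib_right[symmetric])
  also have "\<dots> = - (of_int leg_prod * (\<Sum>i\<le>k. l i * c i))\<^sup>2 / of_int leg_prod + (\<Sum>i\<le>k. (l i)\<^sup>2 * d i)"
    using leg_prod_positive by (simp add: power2_eq_square)
  also have "of_int leg_prod * (\<Sum>i\<le>k. l i * c i) = of_int (leg_prod * m + signed_sum {1..k} leg_prod_except X)"
  proof -
    have "of_int leg_prod * (l i * c i) = of_int (if i \<in> X then leg_prod_except i else - leg_prod_except i)" if i: "i \<in> {1..k}" for i
      using leg_prod_except[OF i] tail_cont_positive[OF i, of 0] i by (simp add: l_def c_def charge_index)
    then have "(\<Sum>i\<in>{1..k}. of_int leg_prod * (l i * c i)) = of_int (signed_sum {1..k} leg_prod_except X)"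
      unfolding signed_sum_def of_int_sum by (intro sum.cong) auto
    then show ?thesis
      unfolding atMost_split by (simp add: distrib_left sum_distrib_left l_def c_def charge_index(1))
  qed
  also have "(\<Sum>i\<le>k. (l i)\<^sup>2 * d i) = (\<Sum>i=1..k. of_int (M' $$ (i, i)) + of_int leg_prod / (of_int (tail_cont i 0))\<^sup>2)"
  proof -
    have "(\<Sum>i\<le>k. (l i)\<^sup>2 * d i) = (\<Sum>i=1..k. (l i)\<^sup>2 * d i)"
      unfolding atMost_split by (simp add: d_def)
    also have "\<dots> = (\<Sum>i=1..k. of_int (M' $$ (i, i)) + of_int leg_prod / (of_int (tail_cont i 0))\<^sup>2)"
      by (rule sum.cong) (auto simp: l_def d_def c_def charge_index power_divide)
    finally show ?thesis .
  qed
  finally show ?thesis .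
qed

lemma weight_charge:
  assumes "X \<subseteq> {1..k}"
  shows "weight (charge m X) = (-1) ^ card X * W_hat k m"
proof -
  have "weight (charge m X) = W_hat k m * ((\<Prod>i\<in>{1..k}. W_hat (deg \<Gamma> i) (vec_index (charge m X) i))
     * (\<Prod>i\<in>{Suc k..<n}. W_hat (deg \<Gamma> i) (vec_index (charge m X) i)))"
    unfolding weight_def vertices_split
    by (subst prod.insert, simp, simp, subst prod.union_disjoint) (auto simp: charge_index(1) deg_node)
  also have "(\<Prod>i\<in>{Suc k..<n}. W_hat (deg \<Gamma> i) (vec_index (charge m X) i)) = 1"
    by (rule prod.neutral) (simp add: charge_index deg_joint W_hat_2)
  also have "(\<Prod>i\<in>{1..k}. W_hat (deg \<Gamma> i) (vec_index (charge m X) i)) = (\<Prod>i\<in>{1..k}. if i \<in> X then - 1 else 1)"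
    by (rule prod.cong) (simp_all only: charge_index deg_leaf W_hat_1, auto)
  also have "\<dots> = (-1) ^ card X"
    using assms by (simp add: prod.If_cases Int_absorb1 flip: prod_constant)
  finally show ?thesis by simp
qed

lemma weight_nonzero_charge:
  assumes l: "l \<in> carrier_vec n" and w: "weight l \<noteq> 0"
  obtains m X where "X \<subseteq> {1..k}" "l = charge m X"
proof
  let ?X = "{i \<in> {1..k}. vec_index l i = 1}"
  have nz: "W_hat (deg \<Gamma> i) (vec_index l i) \<noteq> 0" if "i < n" for i
    using w that unfolding weight_def by (simp add: prod_zero_iff)
  show "?X \<subseteq> {1..k}" by auto
  show "l = charge (vec_index l 0) ?X"
  proof (rule eq_vecI)
    fix i assume "i < dim_vec (charge (vec_index l 0) ?X)"
    then have i: "i < n" by (simp add: charge_def)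
    consider "i = 0" | "i \<in> {1..k}" | "k < i" by force
    then show "vec_index l i = vec_index (charge (vec_index l 0) ?X) i"
    proof cases
      case 2
      then have "W_hat 1 (vec_index l i) \<noteq> 0" using nz[OF i] deg_leaf by simp
      then have "vec_index l i = 1 \<or> vec_index l i = - 1" unfolding W_hat_1 by (auto split: if_splits)
      then show ?thesis using 2 by (auto simp: charge_index)
    next
      case 3
      then have "W_hat 2 (vec_index l i) \<noteq> 0" using nz[OF i] deg_joint[OF _ i] by simp
      then show ?thesis using 3 i by (auto simp: charge_index W_hat_2 split: if_splits)
    qed (simp add: charge_index)
  qed (use l in \<open>simp add: charge_def\<close>)
qed

lemma charge_in_charges:
  assumes k: "k \<ge> 2" and nz: "W_hat k m \<noteq> 0"
  shows "charge m X \<in> charges"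
proof -
  have "W_hat ((k - 2) + 2) m \<noteq> 0" using nz k by (simp only: le_add_diff_inverse2 not_False_eq_True)
  from W_hat_parity[OF this] have "even (m - int k)" using k by (simp add: of_nat_diff)
  have "even (vec_index (charge m X) i - int (deg \<Gamma> i))" if i: "i < n" for i
  proof -
    consider "i = 0" | "i \<in> {1..k}" | "k < i" by force
    then show ?thesis
      using \<open>even (m - int k)\<close> i by cases (auto simp: charge_index deg_node deg_leaf deg_joint)
  qed
  then show ?thesis by (simp add: charges_def)
qed

lemma charge_inject: "X \<subseteq> {1..k} \<Longrightarrow> Y \<subseteq> {1..k} \<Longrightarrow> charge m X = charge m' Y \<Longrightarrow> X = Y"
proof -
  assume XY: "X \<subseteq> {1..k}" "Y \<subseteq> {1..k}" "charge m X = charge m' Y"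
  have "i \<in> X \<longleftrightarrow> i \<in> Y" if i: "i \<in> {1..k}" for i
  proof -
    have "vec_index (charge m X) i = vec_index (charge m' Y) i" using XY by simp
    then show ?thesis unfolding charge_index(2)[OF i] by (auto split: if_splits)
  qed
  then show "X = Y" using XY by auto
qed

abbreviation "leaf_sum X \<equiv> signed_sum {1..k} (\<lambda>_. 1 :: int) X"

text \<open>
  A given exponent of \<open>t\<close> fixes the value at the node once the signs at the leaves are chosen.
\<close>
lemma Z_hat_hat_0_leaf_sum:
  assumes k: "k \<ge> 2"
  shows "Z_hat_hat_0 \<Gamma> e (of_int m / 2) =
    (\<Sum>X\<in>Pow {1..k}. if q_exponent (charge (m - leaf_sum X) X) = e
       then (-1) ^ card X * W_hat k (m - leaf_sum X) else 0)"
proof -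
  let ?l = "\<lambda>X. charge (m - leaf_sum X) X"
  let ?P = "{X \<in> Pow {1..k}. q_exponent (?l X) = e}"
  let ?T = "{l. l \<in> charges \<and> q_exponent l = e \<and> rat_of_int (l \<bullet> u) / 2 = of_int m / 2}"
  have "(\<Sum>l\<in>?T. weight l) = (\<Sum>l\<in>?l ` ?P. weight l)"
  (* The two index sets differ by vectors of weight 0: charges that are not of the form ?l X,
     and vectors ?l X with the wrong parity at the node. *)
  proof (rule sum.mono_neutral_cong)
    show "finite ?T"
      by (rule finite_subset[OF _ finite_q_exponent_level[of e]]) (auto simp: charges_def)
    show "weight l = 0" if l: "l \<in> ?l ` ?P - ?T" for l
    proof (rule ccontr)
      assume "weight l \<noteq> 0"
      obtain X where X: "X \<subseteq> {1..k}" "q_exponent (?l X) = e" "l = ?l X" using l by auto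
      have "W_hat k (m - leaf_sum X) \<noteq> 0" using \<open>weight l \<noteq> 0\<close> X by (simp add: weight_charge)
      then have "l \<in> charges" using charge_in_charges[OF k] X by simp
      then have "l \<in> ?T" using X by (simp add: charge_dot_u)
      then show False using l by simp
    qed
    show "weight l = 0" if l: "l \<in> ?T - ?l ` ?P" for l
    proof (rule ccontr)
      assume w: "weight l \<noteq> 0"
      have "l \<in> carrier_vec n" using l by (simp add: charges_def)
      then obtain m' X where X: "X \<subseteq> {1..k}" "l = charge m' X"
        using weight_nonzero_charge[OF _ w] by blast
      have "m' + leaf_sum X = m" using l X(2) by (simp add: charge_dot_u)
      then have "l = ?l X" using X(2) by auto
      then show False using l X(1) by auto
    qed
  qed auto
  also have "\<dots> = (\<Sum>X\<in>?P. weight (?l X))"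
  proof (rule sum.reindex_cong[of ?l])
    show "inj_on ?l ?P"
    proof (rule inj_onI)
      fix X Y assume "X \<in> ?P" "Y \<in> ?P" "?l X = ?l Y"
      then show "X = Y" using charge_inject[of X Y] by blast
    qed
  qed simp_all
  also have "\<dots> = (\<Sum>X\<in>?P. (-1) ^ card X * W_hat k (m - leaf_sum X))"
    by (rule sum.cong) (auto simp: weight_charge)
  also have "\<dots> = (\<Sum>X\<in>Pow {1..k}. if q_exponent (?l X) = e then (-1) ^ card X * W_hat k (m - leaf_sum X) else 0)"
    by (rule sum.inter_filter) simp
  finally show ?thesis unfolding Z_hat_hat_0_charges .
qed

lemma Z_hat_hat_0_half_integral:
  assumes "Z_hat_hat_0 \<Gamma> e (r / 2) \<noteq> 0"
  obtains m where "r = of_int m"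
proof -
  have "\<exists>l. rat_of_int (l \<bullet> u) / 2 = r / 2"
    using assms unfolding Z_hat_hat_0_charges by (metis (mono_tags, lifting) mem_Collect_eq sum.neutral)
  then show ?thesis using that by auto
qed

text \<open>
  The sets \<open>X\<close> match on both sides: \<open>q_exponent_iff\<close> below compares the exponents of \<open>q\<close>, and the
  coefficients \<open>(-1)\<^bsup>|X|\<^esup> W_hat k\<close> coincide.
\<close>
theorem Z_hat_hat_0_eq:
  assumes k: "k \<ge> 2" and a: "\<And>i. i \<in> {1..k} \<Longrightarrow> a i = tail_cont i 0"
  shows "subst_powers 2 (of_int (homology_order \<Gamma>)) (Z_hat_hat_0 \<Gamma>) =
         q_power_times (Delta \<Gamma> k a) (laplace (A_prod k a) (sym_exp_f0 k a))"
proof (intro ext)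
  fix e r :: rat
  define A where "A = A_prod k a"
  have A: "A = leg_prod" unfolding A_def A_prod_def leg_prod_def by (rule prod.cong) (auto simp: a)
  have A0: "A > 0" using A leg_prod_positive by simp
  have ab: "a_bar k a i = leg_prod_except i" if i: "i \<in> {1..k}" for i
    using leg_prod_except[OF i] tail_cont_positive[OF i, of 0] a[OF i] A by (simp add: a_bar_def A_def[symmetric])
  define N where "N m X = A * (m - leaf_sum X) + signed_sum {1..k} (a_bar k a) X" for m X
  have q_exponent_iff: "q_exponent (charge (m - leaf_sum X) X) = e / of_int ordH
      \<longleftrightarrow> (of_int (N m X))\<^sup>2 / (4 * of_int A) = e - Delta \<Gamma> k a" for m X
  proof -
    have N: "N m X = leg_prod * (m - leaf_sum X) + signed_sum {1..k} leg_prod_except X"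
      unfolding N_def A signed_sum_def by (intro arg_cong2[of _ _ _ _ "(+)"] sum.cong) (auto simp: ab)
    define S where "S = (\<Sum>i=1..k. of_int (M' $$ (i, i)) + of_int leg_prod / (of_int (tail_cont i 0))\<^sup>2 :: rat)"
    define C where "C = rat_of_int (3 * int n + trace_wt \<Gamma>)"
    have "Delta \<Gamma> k a = - (of_int ordH * C) / 4 - S / 4"
      unfolding Delta_def homology_order_eq S_def C_def of_int_mult
      by (intro arg_cong2[of _ _ _ _ "(-)"] arg_cong[of _ _ "\<lambda>x. x / 4"] sum.cong refl) (auto simp: a A[unfolded A_def])
    moreover have "of_int ordH * q_exponent (charge (m - leaf_sum X) X) = - (of_int (dual_form (charge (m - leaf_sum X) X)) + of_int ordH * C) / 4"
      unfolding q_exponent_def C_def[symmetric] using ordH_positive by (simp add: field_simps)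
    moreover have "of_int (dual_form (charge (m - leaf_sum X) X)) = - (of_int (N m X))\<^sup>2 / of_int A + S"
      unfolding dual_form_charge N S_def A ..
    ultimately have "of_int ordH * q_exponent (charge (m - leaf_sum X) X) = (of_int (N m X))\<^sup>2 / (4 * of_int A) + Delta \<Gamma> k a"
      by (simp add: add_divide_distrib diff_divide_distrib)
    moreover have "q_exponent (charge (m - leaf_sum X) X) = e / of_int ordH \<longleftrightarrow> of_int ordH * q_exponent (charge (m - leaf_sum X) X) = e"
      using ordH_positive by (auto simp: field_simps)
    ultimately show ?thesis by auto
  qed
  show "subst_powers 2 (of_int (homology_order \<Gamma>)) (Z_hat_hat_0 \<Gamma>) e r =
         q_power_times (Delta \<Gamma> k a) (laplace (A_prod k a) (sym_exp_f0 k a)) e r"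
  proof (cases "\<exists>m. r = of_int m")
    case False
    then have "Z_hat_hat_0 \<Gamma> (e / of_int ordH) (r / 2) = 0" using Z_hat_hat_0_half_integral by blast
    moreover have no: "{(N, m). (rat_of_int N)\<^sup>2 / (4 * of_int (A_prod k a)) = e - Delta \<Gamma> k a \<and> of_int m = r} = {}"
      using False by auto
    ultimately show ?thesis
      by (simp only: subst_powers_def homology_order_eq q_power_times_def laplace_def no sum.empty)
  next
    case True
    then obtain m where m: "r = of_int m" by blast
    let ?NS = "{N::int. (of_int N)\<^sup>2 / (4 * of_int A) = e - Delta \<Gamma> k a}"
    have finNS: "finite ?NS" using A0 by (intro finite_square_level) simp
    have dom: "{(N, m'). (rat_of_int N)\<^sup>2 / (4 * of_int A) = e - Delta \<Gamma> k a \<and> of_int m' = r} = (\<lambda>N. (N, m)) ` ?NS"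
      using m by auto
    have "q_power_times (Delta \<Gamma> k a) (laplace (A_prod k a) (sym_exp_f0 k a)) e r
        = (\<Sum>(N, m')\<in>(\<lambda>N. (N, m)) ` ?NS. sym_exp_f0 k a N m')"
      unfolding q_power_times_def laplace_def A_def[symmetric] dom ..
    also have "\<dots> = (\<Sum>N\<in>?NS. sym_exp_f0 k a N m)"
      by (subst sum.reindex) (auto simp: inj_on_def)
    also have "\<dots> = (\<Sum>N'\<in>?NS. \<Sum>X\<in>Pow {1..k}. if N' = - N m X then (-1) ^ card X * W_hat k (m - leaf_sum X) else 0)"
      using sym_exp_f0_eq[of k a _ m] A0 k by (simp add: N_def A_def)
    also have "\<dots> = (\<Sum>X\<in>Pow {1..k}. \<Sum>N'\<in>?NS. if N' = - N m X then (-1) ^ card X * W_hat k (m - leaf_sum X) else 0)"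
      by (rule sum.swap)
    also have "\<dots> = (\<Sum>X\<in>Pow {1..k}. if q_exponent (charge (m - leaf_sum X) X) = e / of_int ordH
       then (-1) ^ card X * W_hat k (m - leaf_sum X) else 0)"
    proof (rule sum.cong[OF refl])
      fix X assume "X \<in> Pow {1..k}"
      show "(\<Sum>N'\<in>?NS. if N' = - N m X then (-1) ^ card X * W_hat k (m - leaf_sum X) else 0)
        = (if q_exponent (charge (m - leaf_sum X) X) = e / of_int ordH then (-1) ^ card X * W_hat k (m - leaf_sum X) else 0)"
        unfolding q_exponent_iff sum.delta[OF finNS] by simp
    qed
    also have "\<dots> = Z_hat_hat_0 \<Gamma> (e / of_int ordH) (r / 2)"
      unfolding m by (rule Z_hat_hat_0_leaf_sum[OF k, symmetric])
    finally show ?thesis by (simp add: subst_powers_def homology_order_eq)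
  qed
qed

end

lemma negative_definite_int_form:
  assumes "negative_definite (map_mat real_of_int A)" "A \<in> carrier_mat n n"
    and v: "v < n" "x v \<noteq> 0"
  shows "(\<Sum>v<n. x v * (\<Sum>w<n. A $$ (v, w) * x w)) < 0"
proof -
  let ?x = "vec n (\<lambda>v. real_of_int (x v))"
  have "vec_index ?x v \<noteq> 0" using v by simp
  then have "?x \<noteq> 0\<^sub>v n" using v(1) by (metis index_zero_vec(1))
  then have "?x \<bullet> (map_mat real_of_int A *\<^sub>v ?x) < 0"
    using assms(1,2) by (auto simp: negative_definite_def)
  also have "?x \<bullet> (map_mat real_of_int A *\<^sub>v ?x) = of_int (\<Sum>v<n. x v * (\<Sum>w<n. A $$ (v, w) * x w))"
    using assms(2) by (auto simp: scalar_prod_def atLeast0LessThan intro!: sum.cong)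
  finally show ?thesis by (simp only: of_int_less_0_iff)
qed

text \<open>
  It remains to identify \<open>a i\<close> with the continuant of leg \<open>i\<close>: both are the positive numerator in
  lowest terms of the same fraction.
\<close>
theorem theorem1p1:
  fixes \<Gamma> :: plumbing and b :: int and k :: nat and a \<beta> :: "nat \<Rightarrow> int"
  assumes "seifert_plumbing \<Gamma> b k a \<beta>"
    and "negative_definite (map_mat real_of_int (plumbing_matrix \<Gamma>))"
    and "betti1 \<Gamma> = 0"
  shows "subst_powers 2 (of_int (homology_order \<Gamma>)) (Z_hat_hat_0 \<Gamma>) =
         q_power_times (Delta \<Gamma> k a) (laplace (A_prod k a) (sym_exp_f0 k a))"
proof -
  note S = assms(1)[unfolded seifert_plumbing_def]
  from S have tree: "plumbing_tree \<Gamma>" by (elim conjE)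
  from S have k: "3 \<le> k" by (elim conjE)
  from S have ab: "\<forall>i \<in> {1..k}. 0 < a i \<and> coprime (a i) (\<beta> i)" by (elim conjE)
  from S obtain legs where
    legs: "\<forall>i \<in> {1..k}. legs i \<noteq> [] \<and> last (legs i) = i \<and>
           of_int (a i) / of_int (\<beta> i) = neg_cont_frac (map (\<lambda>v. rat_of_int (- wt \<Gamma> v)) (legs i))"
    and dist: "distinct (concat (map legs [1..<Suc k]))"
    and set: "set (concat (map legs [1..<Suc k])) = {1..<nverts \<Gamma>}"
    and adj: "\<forall>u v. adj \<Gamma> u v \<longleftrightarrow> (\<exists>i \<in> {1..k}. \<exists>j < length (legs i).
              {u, v} = {(0 # legs i) ! j, (0 # legs i) ! Suc j})"
    by (elim conjE exE) (rule that; assumption)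
  interpret star_plumbing \<Gamma> k legs
  proof
    show "0 < nverts \<Gamma>" using tree by (simp add: plumbing_tree_def)
    show "legs i \<noteq> []" "last (legs i) = i" if "i \<in> {1..k}" for i using bspec[OF legs that] by blast+
  qed (fact dist set adj[rule_format])+
  interpret negative_star_plumbing \<Gamma> k legs
  proof
    fix x v assume "v < nverts \<Gamma>" "x v \<noteq> (0::int)"
    then show "(\<Sum>v<nverts \<Gamma>. x v * mrow x v) < 0"
      unfolding mrow_def
      using negative_definite_int_form[OF assms(2), of "nverts \<Gamma>" v x] by (simp add: plumbing_matrix_def)
  qed
  have "a i = tail_cont i 0" if i: "i \<in> {1..k}" for i
  proof -
    let ?cs = "map (\<lambda>v. - wt \<Gamma> v) (legs i)"
    obtain c cs where cs: "?cs = c # cs" using bspec[OF legs i] by (cases ?cs) auto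
    have pos: "continuant (drop j ?cs) > 0" if "j \<le> length ?cs" for j
      using tail_cont_positive[OF i, of j] that by (simp add: tail_cont_def)
    have "map (\<lambda>v. rat_of_int (- wt \<Gamma> v)) (legs i) = map rat_of_int ?cs" by simp
    then have "rat_of_int (a i) / of_int (\<beta> i) = of_int (continuant (c # cs)) / of_int (continuant cs)"
      using bspec[OF legs i] neg_cont_frac_continuant[of ?cs, OF pos] unfolding cs by simp
    moreover have "continuant (c # cs) > 0" "continuant cs > 0"
      using pos[of 0] pos[of 1] unfolding cs by simp_all
    ultimately have "a i = continuant (c # cs)"
      using bspec[OF ab i] coprime_continuant[of c cs] by (intro fraction_lowest_terms_unique[of _ "\<beta> i" _ "continuant cs"]) auto
    then show ?thesis using cs by (simp add: tail_cont_def)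
  qed
  then show ?thesis using k by (intro Z_hat_hat_0_eq) auto
qed

end
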